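(* Assume that the value function $V$ that solves the HJI equation of the reachability problem with dynamics $\dot x=f(x,u,d)$ is locally Lipschitz with locally Lipschitz gradients, i.e. $V\in C^{1,1}_{\mathrm{loc}}([0,T]\times\mathbb{R}^n)$. Consider the neural networks $V_\theta$ described in the context, with smooth, bounded, non-constant activation $\sigma$. For every $\varepsilon>0$, there exists a constant $C>0$ that depends only on the dynamics $\dot x=f(x,u,d)$ of the underlying reachability problem such that for some $\theta\in\mathbb{R}^P$, the DeepReach loss satisfies $L(\theta)\le C\varepsilon$.
   Context: Reachability problem. Let $T>0$. The state $x\in\mathbb{R}^n$ evolves by $\dot x=f(x,u,d)$ with control $u\in\mathcal U\subseteq\mathbb{R}^m$ and disturbance $d\in\mathcal D\subseteq\mathbb{R}^m$; $\xi^{u,d}_{x,t}(\tau)$ is the state at time $\tau$ when starting at state $x$ and time $t$ under $u(\cdot)$ and $d(\cdot)$. A function $\ell:\mathbb{R}^n\to\mathbb{R}$ has the target set as its sublevel set $\{\ell\le0\}$. The cost is $J(x,t,u(\cdot),d(\cdot))=\min_{\tau\in[t,T]}\ell(\xi^{u,d}_{x,t}(\tau))$ and the value function is $V(t,x)=\inf_{d(\cdot)}\sup_{u(\cdot)}J(x,t,u(\cdot),d(\cdot))$. HJI equation. With $H(t,x)=\sup_u\inf_d\langle\nabla_xV(t,x),f(x,u,d)\rangle$, it reads $$\min\{\partial_tV(t,x)+H(t,x),\ \ell(x)-V(t,x)\}=0,\qquad V(T,x)=\ell(x).$$ Assumption A. (1) $\mathcal U$ and $\mathcal D$ are compact, and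 all controls and disturbances take values in them. (2) There is a compact set $K\subseteq\mathbb{R}^n$ such that for any initial state $x(0)\in K$ and any sequence of optimal control inputs and disturbances $u\in\mathcal U$, $d\in\mathcal D$, the state trajectory satisfies $x(t)\in K$ for all $t\in[0,T]$. (3) There is a constant $C_f>0$ such that for any $x\in K$, $\|f(x,u,d)\|_2\le C_f$ for all $(u,d)\in\mathcal U\times\mathcal D$. Write $\Omega_K=[0,T]\times K$. Assumption B. There exists a unique classical solution $V\in C^{1,1}(\Omega_K)$ (Lipschitz with Lipschitz gradient) to the HJI equation, and $V$ is also its unique viscosity solution, in the following sense. For $\varphi\in C^1$ put $\mathcal L[\varphi](t,x)=\min\{\partial_t\varphi(t,x)+\sup_u\inf_d\langle\nabla_x\varphi(t,x),f(x,u,d)\rangle,\ \ell(x)-\varphi(t,x)\}$. A function $v\in C((0,T)\times\mathrm{Int}(K))$ is a viscosity subsolution if for any test function $\varphi\in C^1((0,T)\times\mathrm{Int}(K))$, $\mathcal L[\varphi]\le0$ at every local maximum $(t_0,x_0)\in(0,T)\times\mathrm{Int}(K)$ of $v-\varphi$; a viscosity supersolution if for any such $\varphi$, $\mathcal L[\varphi]\ge0$ at every local minimum $(t_0,x_0)\in(0,T)\times\mathrm{Int}(K)$ of $v-\varphi$; and a viscosity solution if it is both. Networks. The fully connected networks with $L$ layers and common activation $\sigma$ (applied elementwise) are $$V_\theta(t,x)=\sigma(W_L\cdots\sigma(W_1x+\alpha t+c_1)\cdots+c_L),$$ with weight matrices $W_i$, bias vectors $c_i$ and a scalar weight $\alpha$.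 The parameters are $\theta=(W_1,\dots,W_L,c_1,\dots,c_L,\alpha)\in\mathbb{R}^P$ (matrices flattened), where $P$ depends on the maximum width, the depth $L$ and the dimension $n$. $\mathfrak C_{n+1}(\sigma)$ denotes the class of all such networks with parameters of any dimension (any number of layers, unbounded width). DeepReach loss. With $H_\theta(t,x)=\sup_u\inf_d\langle\nabla_xV_\theta(t,x),f(x,u,d)\rangle$, a tunable parameter $\lambda>0$, and $\|\cdot\|_\infty$ the supremum norm on $\Omega_K$ (over $x\in K$ in the first term), $$L(\theta)=\|V_\theta(T,x)-\ell(x)\|_\infty+\lambda\,\|\min\{\partial_tV_\theta(t,x)+H_\theta(t,x),\ \ell(x)-V_\theta(t,x)\}\|_\infty .$$
   Formalization: The outermost σ is dropped, so the output layer is affine (with bounded σ the networks could not approximate a V outside its range); viscosity test functions are normalised to touch v, and viscosity solutions must attain the terminal condition. *)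

theory Defs
  imports "HOL-Analysis.Analysis"
begin

section \<open>The reachability problem\<close>

text \<open>
  Inputs on the horizon \<open>[t,T]\<close> are the Lebesgue measurable functions with values in the
  given input set; values outside \<open>[t,T]\<close> are irrelevant.
\<close>

definition signals :: "(real ^ 'm) set \<Rightarrow> real \<Rightarrow> real \<Rightarrow> (real \<Rightarrow> real ^ 'm) set" where
  "signals U t T = {u. u \<in> borel_measurable (lebesgue_on {t..T}) \<and> (\<forall>s\<in>{t..T}. u s \<in> U)}"

text \<open>
  Inputs are merely measurable, so \<open>x' = f(x,u,d)\<close> is understood in the sense of
  Caratheodory: \<open>y\<close> is the absolutely continuous solution of the integral equation.
\<close>

definition is_trajectory ::
    "(real ^ 'n \<Rightarrow> real ^ 'm \<Rightarrow> real ^ 'm \<Rightarrow> real ^ 'n) \<Rightarrow> real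
      \<Rightarrow> (real \<Rightarrow> real ^ 'm) \<Rightarrow> (real \<Rightarrow> real ^ 'm) \<Rightarrow> real ^ 'n \<Rightarrow> real \<Rightarrow> (real \<Rightarrow> real ^ 'n) \<Rightarrow> bool" where
  "is_trajectory f T u d x t y \<longleftrightarrow>
     (\<lambda>s. f (y s) (u s) (d s)) absolutely_integrable_on {t..T} \<and>
     (\<forall>\<tau>\<in>{t..T}. y \<tau> = x + integral {t..\<tau>} (\<lambda>s. f (y s) (u s) (d s)))"

text \<open>
  \<open>\<xi> u d x t \<tau>\<close> is the state at time \<open>\<tau>\<close>: the notation presupposes that trajectories
  exist up to time \<open>T\<close> and are unique.
\<close>

type_synonym ('n, 'm) flow =
  "(real \<Rightarrow> real ^ 'm) \<Rightarrow> (real \<Rightarrow> real ^ 'm) \<Rightarrow> real ^ 'n \<Rightarrow> real \<Rightarrow> real \<Rightarrow> real ^ 'n"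

definition is_state_map ::
    "(real ^ 'n \<Rightarrow> real ^ 'm \<Rightarrow> real ^ 'm \<Rightarrow> real ^ 'n) \<Rightarrow> (real ^ 'm) set \<Rightarrow> (real ^ 'm) set \<Rightarrow> real
      \<Rightarrow> ('n, 'm) flow \<Rightarrow> bool" where
  "is_state_map f U D T \<xi> \<longleftrightarrow>
     (\<forall>x. \<forall>t\<in>{0..T}. \<forall>u\<in>signals U t T. \<forall>d\<in>signals D t T.
        is_trajectory f T u d x t (\<xi> u d x t) \<and>
        (\<forall>y. is_trajectory f T u d x t y \<longrightarrow> (\<forall>\<tau>\<in>{t..T}. y \<tau> = \<xi> u d x t \<tau>)))"

text \<open>
  Cost and value are taken in the extended reals so that no infimum or supremum is unspecified.
  For continuous \<open>ell\<close> the infimum over the compact interval \<open>[t,T]\<close> is a minimum.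
\<close>

definition cost ::
    "(real ^ 'n \<Rightarrow> real) \<Rightarrow> real \<Rightarrow> ('n, 'm) flow \<Rightarrow> real ^ 'n \<Rightarrow> real
      \<Rightarrow> (real \<Rightarrow> real ^ 'm) \<Rightarrow> (real \<Rightarrow> real ^ 'm) \<Rightarrow> ereal" where
  "cost ell T \<xi> x t u d = (INF \<tau>\<in>{t..T}. ereal (ell (\<xi> u d x t \<tau>)))"

definition game_value ::
    "(real ^ 'm) set \<Rightarrow> (real ^ 'm) set \<Rightarrow> (real ^ 'n \<Rightarrow> real) \<Rightarrow> real \<Rightarrow> ('n, 'm) flow
      \<Rightarrow> real \<Rightarrow> real ^ 'n \<Rightarrow> ereal" where
  "game_value U D ell T \<xi> t x =
     (INF d\<in>signals D t T. SUP u\<in>signals U t T. cost ell T \<xi> x t u d)"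

definition is_value_function ::
    "(real ^ 'm) set \<Rightarrow> (real ^ 'm) set \<Rightarrow> (real ^ 'n \<Rightarrow> real) \<Rightarrow> real \<Rightarrow> ('n, 'm) flow
      \<Rightarrow> (real \<Rightarrow> real ^ 'n \<Rightarrow> real) \<Rightarrow> bool" where
  "is_value_function U D ell T \<xi> V \<longleftrightarrow>
     (\<forall>t\<in>{0..T}. \<forall>x. ereal (V t x) = game_value U D ell T \<xi> t x)"

definition optimal_inputs ::
    "(real ^ 'm) set \<Rightarrow> (real ^ 'm) set \<Rightarrow> (real ^ 'n \<Rightarrow> real) \<Rightarrow> real \<Rightarrow> ('n, 'm) flow
      \<Rightarrow> real ^ 'n \<Rightarrow> real \<Rightarrow> (real \<Rightarrow> real ^ 'm) \<Rightarrow> (real \<Rightarrow> real ^ 'm) \<Rightarrow> bool" where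
  "optimal_inputs U D ell T \<xi> x t u d \<longleftrightarrow>
     u \<in> signals U t T \<and> d \<in> signals D t T \<and>
     (SUP u'\<in>signals U t T. cost ell T \<xi> x t u' d) = game_value U D ell T \<xi> t x \<and>
     cost ell T \<xi> x t u d = (SUP u'\<in>signals U t T. cost ell T \<xi> x t u' d)"

definition assumption_A ::
    "(real ^ 'n \<Rightarrow> real ^ 'm \<Rightarrow> real ^ 'm \<Rightarrow> real ^ 'n) \<Rightarrow> (real ^ 'm) set \<Rightarrow> (real ^ 'm) set
      \<Rightarrow> (real ^ 'n \<Rightarrow> real) \<Rightarrow> real \<Rightarrow> ('n, 'm) flow \<Rightarrow> (real ^ 'n) set \<Rightarrow> bool" where
  "assumption_A f U D ell T \<xi> K \<longleftrightarrow>
     compact U \<and> U \<noteq> {} \<and> compact D \<and> D \<noteq> {} \<and>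
     compact K \<and>
     (\<forall>x\<in>K. \<forall>u d. optimal_inputs U D ell T \<xi> x 0 u d \<longrightarrow> (\<forall>t\<in>{0..T}. \<xi> u d x 0 t \<in> K)) \<and>
     (\<exists>Cf>0. \<forall>x\<in>K. \<forall>u\<in>U. \<forall>d\<in>D. norm (f x u d) \<le> Cf)"


section \<open>The Hamilton-Jacobi-Isaacs equation\<close>

text \<open>The time derivative is one-sided at the endpoints \<open>0\<close> and \<open>T\<close>.\<close>

definition time_deriv :: "real \<Rightarrow> (real \<Rightarrow> real ^ 'n \<Rightarrow> real) \<Rightarrow> real \<Rightarrow> real ^ 'n \<Rightarrow> real" where
  "time_deriv T v t x = vector_derivative (\<lambda>s. v s x) (at t within {0..T})"

definition space_grad :: "(real \<Rightarrow> real ^ 'n \<Rightarrow> real) \<Rightarrow> real \<Rightarrow> real ^ 'n \<Rightarrow> real ^ 'n" where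
  "space_grad v t x = (THE g. GDERIV (v t) x :> g)"

definition hamiltonian ::
    "(real ^ 'n \<Rightarrow> real ^ 'm \<Rightarrow> real ^ 'm \<Rightarrow> real ^ 'n) \<Rightarrow> (real ^ 'm) set \<Rightarrow> (real ^ 'm) set
      \<Rightarrow> (real \<Rightarrow> real ^ 'n \<Rightarrow> real) \<Rightarrow> real \<Rightarrow> real ^ 'n \<Rightarrow> real" where
  "hamiltonian f U D v t x = (SUP u\<in>U. INF d\<in>D. space_grad v t x \<bullet> f x u d)"

definition HJI_op ::
    "(real ^ 'n \<Rightarrow> real ^ 'm \<Rightarrow> real ^ 'm \<Rightarrow> real ^ 'n) \<Rightarrow> (real ^ 'm) set \<Rightarrow> (real ^ 'm) set
      \<Rightarrow> (real ^ 'n \<Rightarrow> real) \<Rightarrow> real \<Rightarrow> (real \<Rightarrow> real ^ 'n \<Rightarrow> real) \<Rightarrow> real \<Rightarrow> real ^ 'n \<Rightarrow> real" where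
  "HJI_op f U D ell T v t x =
     min (time_deriv T v t x + hamiltonian f U D v t x) (ell x - v t x)"

text \<open>
  In \<open>C11_on\<close> and \<open>C11_loc\<close> the full gradient \<open>G\<close> is that of \<open>v\<close> on \<open>[0,T] \<times> \<real>\<^sup>n\<close>, where it is
  unique. So membership in \<open>C\<^sup>1\<^sup>,\<^sup>1\<close> of \<open>[0,T] \<times> K\<close>, for an arbitrary compact \<open>K\<close>, means that the
  restriction to \<open>[0,T] \<times> K\<close> is Lipschitz with Lipschitz gradient, the gradient at a boundary
  point of \<open>K\<close> being that of the given extension.
\<close>

definition C11_on :: "real \<Rightarrow> (real ^ 'n) set \<Rightarrow> (real \<Rightarrow> real ^ 'n \<Rightarrow> real) \<Rightarrow> bool" where
  "C11_on T K v \<longleftrightarrow>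
     (\<exists>G L. (\<forall>p\<in>{0..T} \<times> K.
               (case_prod v has_derivative (\<lambda>h. G p \<bullet> h)) (at p within {0..T} \<times> UNIV)) \<and>
            L-lipschitz_on ({0..T} \<times> K) (case_prod v) \<and>
            L-lipschitz_on ({0..T} \<times> K) G)"

definition locally_lipschitz_on :: "'a::metric_space set \<Rightarrow> ('a \<Rightarrow> 'b::metric_space) \<Rightarrow> bool" where
  "locally_lipschitz_on S g \<longleftrightarrow> (\<forall>p\<in>S. \<exists>r>0. \<exists>L. L-lipschitz_on (S \<inter> ball p r) g)"

definition C11_loc :: "real \<Rightarrow> (real \<Rightarrow> real ^ 'n \<Rightarrow> real) \<Rightarrow> bool" where
  "C11_loc T v \<longleftrightarrow>
     (\<exists>G. (\<forall>p\<in>{0..T} \<times> UNIV.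
             (case_prod v has_derivative (\<lambda>h. G p \<bullet> h)) (at p within {0..T} \<times> UNIV)) \<and>
          locally_lipschitz_on ({0..T} \<times> UNIV) (case_prod v) \<and>
          locally_lipschitz_on ({0..T} \<times> UNIV) G)"

definition classical_solution ::
    "(real ^ 'n \<Rightarrow> real ^ 'm \<Rightarrow> real ^ 'm \<Rightarrow> real ^ 'n) \<Rightarrow> (real ^ 'm) set \<Rightarrow> (real ^ 'm) set
      \<Rightarrow> (real ^ 'n \<Rightarrow> real) \<Rightarrow> real \<Rightarrow> (real ^ 'n) set \<Rightarrow> (real \<Rightarrow> real ^ 'n \<Rightarrow> real) \<Rightarrow> bool" where
  "classical_solution f U D ell T K v \<longleftrightarrow>
     C11_on T K v \<and>
     (\<forall>t\<in>{0..T}. \<forall>x\<in>K. HJI_op f U D ell T v t x = 0) \<and>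
     (\<forall>x\<in>K. v T x = ell x)"

definition C1_on :: "(real \<times> (real ^ 'n)) set \<Rightarrow> (real \<Rightarrow> real ^ 'n \<Rightarrow> real) \<Rightarrow> bool" where
  "C1_on S \<phi> \<longleftrightarrow>
     (\<exists>G. continuous_on S G \<and> (\<forall>p\<in>S. (case_prod \<phi> has_derivative (\<lambda>h. G p \<bullet> h)) (at p)))"

text \<open>
  Test functions are normalised to touch \<open>v\<close> at the extremum, as usual. Since \<open>HJI_op\<close> contains
  the value of \<open>\<phi>\<close> itself, without the normalisation one could add a large constant to \<open>\<phi>\<close> and
  no function would be a supersolution.
\<close>

definition viscosity_subsolution ::
    "(real ^ 'n \<Rightarrow> real ^ 'm \<Rightarrow> real ^ 'm \<Rightarrow> real ^ 'n) \<Rightarrow> (real ^ 'm) set \<Rightarrow> (real ^ 'm) set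
      \<Rightarrow> (real ^ 'n \<Rightarrow> real) \<Rightarrow> real \<Rightarrow> (real ^ 'n) set \<Rightarrow> (real \<Rightarrow> real ^ 'n \<Rightarrow> real) \<Rightarrow> bool" where
  "viscosity_subsolution f U D ell T K v \<longleftrightarrow>
     continuous_on ({0<..<T} \<times> interior K) (case_prod v) \<and>
     (\<forall>\<phi>. C1_on ({0<..<T} \<times> interior K) \<phi> \<longrightarrow>
        (\<forall>t\<in>{0<..<T}. \<forall>x\<in>interior K.
           \<phi> t x = v t x \<and> (\<forall>\<^sub>F (s, y) in nhds (t, x). v s y - \<phi> s y \<le> v t x - \<phi> t x)
             \<longrightarrow> HJI_op f U D ell T \<phi> t x \<le> 0))"

definition viscosity_supersolution ::
    "(real ^ 'n \<Rightarrow> real ^ 'm \<Rightarrow> real ^ 'm \<Rightarrow> real ^ 'n) \<Rightarrow> (real ^ 'm) set \<Rightarrow> (real ^ 'm) set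
      \<Rightarrow> (real ^ 'n \<Rightarrow> real) \<Rightarrow> real \<Rightarrow> (real ^ 'n) set \<Rightarrow> (real \<Rightarrow> real ^ 'n \<Rightarrow> real) \<Rightarrow> bool" where
  "viscosity_supersolution f U D ell T K v \<longleftrightarrow>
     continuous_on ({0<..<T} \<times> interior K) (case_prod v) \<and>
     (\<forall>\<phi>. C1_on ({0<..<T} \<times> interior K) \<phi> \<longrightarrow>
        (\<forall>t\<in>{0<..<T}. \<forall>x\<in>interior K.
           \<phi> t x = v t x \<and> (\<forall>\<^sub>F (s, y) in nhds (t, x). v s y - \<phi> s y \<ge> v t x - \<phi> t x)
             \<longrightarrow> HJI_op f U D ell T \<phi> t x \<ge> 0))"

text \<open>
  The terminal condition belongs to the equation. A candidate lives on the open cylinder, so it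
  has to be attained as a limit.
\<close>

definition viscosity_solution ::
    "(real ^ 'n \<Rightarrow> real ^ 'm \<Rightarrow> real ^ 'm \<Rightarrow> real ^ 'n) \<Rightarrow> (real ^ 'm) set \<Rightarrow> (real ^ 'm) set
      \<Rightarrow> (real ^ 'n \<Rightarrow> real) \<Rightarrow> real \<Rightarrow> (real ^ 'n) set \<Rightarrow> (real \<Rightarrow> real ^ 'n \<Rightarrow> real) \<Rightarrow> bool" where
  "viscosity_solution f U D ell T K v \<longleftrightarrow>
     viscosity_subsolution f U D ell T K v \<and>
     viscosity_supersolution f U D ell T K v \<and>
     (\<forall>x\<in>interior K. (case_prod v \<longlongrightarrow> ell x) (at (T, x) within {0<..<T} \<times> interior K))"

definition assumption_B ::
    "(real ^ 'n \<Rightarrow> real ^ 'm \<Rightarrow> real ^ 'm \<Rightarrow> real ^ 'n) \<Rightarrow> (real ^ 'm) set \<Rightarrow> (real ^ 'm) set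
      \<Rightarrow> (real ^ 'n \<Rightarrow> real) \<Rightarrow> real \<Rightarrow> (real ^ 'n) set \<Rightarrow> (real \<Rightarrow> real ^ 'n \<Rightarrow> real) \<Rightarrow> bool" where
  "assumption_B f U D ell T K V \<longleftrightarrow>
     classical_solution f U D ell T K V \<and>
     (\<forall>w. classical_solution f U D ell T K w \<longrightarrow> (\<forall>t\<in>{0..T}. \<forall>x\<in>K. w t x = V t x)) \<and>
     viscosity_solution f U D ell T K V \<and>
     (\<forall>w. viscosity_solution f U D ell T K w \<longrightarrow>
        (\<forall>t\<in>{0<..<T}. \<forall>x\<in>interior K. w t x = V t x))"


section \<open>Networks and the DeepReach loss\<close>

definition smooth_activation :: "(real \<Rightarrow> real) \<Rightarrow> bool" where
  "smooth_activation \<sigma> \<longleftrightarrow> (\<forall>k x. (deriv ^^ k) \<sigma> differentiable (at x))"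

text \<open>
  Parameters of a network with \<open>L = hidden + 1\<close> layers, layers and neurons being numbered
  from 0: \<open>in_weight j\<close> is row \<open>j\<close> of \<open>W\<^sub>1\<close>, \<open>weight i\<close> is \<open>W\<^sub>i\<^sub>+\<^sub>1\<close> for \<open>i \<ge> 1\<close>, \<open>bias i\<close> is
  \<open>c\<^sub>i\<^sub>+\<^sub>1\<close> and \<open>width i\<close> is the number of neurons of hidden layer \<open>i\<close>. Entries beyond the widths
  are never used, so every parameter is a vector in some \<open>\<real>\<^sup>P\<close>, and the type comprises all depths
  and widths.
\<close>

record 'n network =
  hidden :: nat
  width :: "nat \<Rightarrow> nat"
  in_weight :: "nat \<Rightarrow> real ^ 'n"
  time_weight :: real
  weight :: "nat \<Rightarrow> nat \<Rightarrow> nat \<Rightarrow> real"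
  bias :: "nat \<Rightarrow> nat \<Rightarrow> real"

text \<open>\<open>preact \<sigma> \<theta> t x i j\<close> is the argument of \<open>\<sigma>\<close> at neuron \<open>j\<close> of layer \<open>i\<close>.\<close>

primrec preact ::
    "(real \<Rightarrow> real) \<Rightarrow> 'n network \<Rightarrow> real \<Rightarrow> real ^ 'n \<Rightarrow> nat \<Rightarrow> nat \<Rightarrow> real" where
  "preact \<sigma> \<theta> t x 0 = (\<lambda>j. in_weight \<theta> j \<bullet> x + time_weight \<theta> * t + bias \<theta> 0 j)"
| "preact \<sigma> \<theta> t x (Suc i) =
     (\<lambda>j. (\<Sum>k<width \<theta> i. weight \<theta> (Suc i) j k * \<sigma> (preact \<sigma> \<theta> t x i k)) + bias \<theta> (Suc i) j)"

text \<open>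
  The scalar output is neuron 0 of the last layer, \<open>W\<^sub>L \<sigma>(\<cdots> \<sigma>(W\<^sub>1 x + \<alpha> t + c\<^sub>1) \<cdots>) + c\<^sub>L\<close>. The
  output layer is affine, as in Hornik's class of networks: with the bounded \<open>\<sigma>\<close> applied once
  more, the values of the network would be confined to the range of \<open>\<sigma>\<close>.
\<close>

definition network_fun :: "(real \<Rightarrow> real) \<Rightarrow> 'n network \<Rightarrow> real \<Rightarrow> real ^ 'n \<Rightarrow> real" where
  "network_fun \<sigma> \<theta> t x = preact \<sigma> \<theta> t x (hidden \<theta>) 0"

definition sup_norm_on :: "'a set \<Rightarrow> ('a \<Rightarrow> real) \<Rightarrow> ennreal" where
  "sup_norm_on S g = (SUP p\<in>S. ennreal \<bar>g p\<bar>)"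

definition deepreach_loss ::
    "(real ^ 'n \<Rightarrow> real ^ 'm \<Rightarrow> real ^ 'm \<Rightarrow> real ^ 'n) \<Rightarrow> (real ^ 'm) set \<Rightarrow> (real ^ 'm) set
      \<Rightarrow> (real ^ 'n \<Rightarrow> real) \<Rightarrow> real \<Rightarrow> (real ^ 'n) set \<Rightarrow> real \<Rightarrow> (real \<Rightarrow> real) \<Rightarrow> 'n network
      \<Rightarrow> ennreal" where
  "deepreach_loss f U D ell T K lam \<sigma> \<theta> =
     sup_norm_on K (\<lambda>x. network_fun \<sigma> \<theta> T x - ell x) +
     ennreal lam *
       sup_norm_on ({0..T} \<times> K) (\<lambda>(t, x). HJI_op f U D ell T (network_fun \<sigma> \<theta>) t x)"

end

theory Submission
  imports Defs
begin

text \<open>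
  The value function satisfies the HJI equation exactly on \<open>[0,T] \<times> K\<close>, and the HJI operator is
  Lipschitz in the value and the first derivatives of its argument, with a constant governed by
  the bound \<open>C\<^sub>f\<close> on the dynamics: a supremum of infima of \<open>\<langle>g, f(x,u,d)\<rangle>\<close> changes by at most
  \<open>C\<^sub>f \<delta>\<close> when \<open>g\<close> changes by \<open>\<delta>\<close> (\<open>HJI_op_close\<close>). A network that is \<open>\<delta>\<close>-close to \<open>V\<close> in \<open>C\<^sup>1\<close> on
  \<open>[0,T] \<times> K\<close> therefore has loss at most \<open>\<delta> + \<lambda> (1 + C\<^sub>f) \<delta>\<close>. As \<open>\<delta>\<close> may be chosen after all other
  data, this is at most \<open>\<epsilon>\<close>, so that \<open>C = 1\<close> will do. What remains is that networks are dense in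
  \<open>C\<^sup>1\<close> on compact sets (\<open>network_C1_approximation\<close>), and this is shown in two independent steps.

  Polynomials are dense in \<open>C\<^sup>1\<close> on a box (\<open>C1_imp_poly_C1_approximable\<close>). In one variable the
  derivative of a Bernstein polynomial is the Bernstein average of difference quotients, so the
  approximation is automatically one in \<open>C\<^sup>1\<close>. Applying the Bernstein operator in one coordinate
  only replaces a function by a combination of polynomials in that coordinate with slices of the
  function as coefficients. The slices no longer depend on the coordinate, and induction over the
  coordinates finishes the argument.

  Networks approximate polynomials in \<open>C\<^sup>1\<close> (\<open>polynomial_network_C1_limit\<close>). A bounded
  non-constant smooth \<open>\<sigma>\<close> is not affine, so \<open>\<sigma>'\<close> and \<open>\<sigma>''\<close> are both non-zero somewhere. First and
  second difference quotients of \<open>\<sigma>\<close> at such points with step \<open>\<alpha>\<close> converge to \<open>y\<close> and \<open>y\<^sup>2\<close> as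
  \<open>\<alpha> \<rightarrow> 0\<close>. The first allows a layer to pass on the functions computed by the layer below, the second
  adds squares and hence, by polarisation, products. The time weight is shared by all neurons of
  the first layer, so networks with one hidden layer and a fixed time weight need not be dense: for
  \<open>\<sigma> = sin\<close> they oscillate in \<open>t\<close> with the frequency \<open>\<alpha>\<close> only. This is why the time weight itself is
  used as the step \<open>\<alpha>\<close>: in the limit \<open>\<alpha> \<rightarrow> 0\<close> the first hidden layer produces \<open>\<langle>w, x\<rangle> + t\<close> for every
  \<open>w\<close>, and these functions generate the algebra of polynomials. The same \<open>\<alpha>\<close> serves as the step in
  all layers, so that functions approximated separately can be computed by one network.
\<close>

section \<open>Bernstein polynomials and their derivatives\<close>

text \<open>
  The left-hand side is the variance \<open>x (1 - x) / n\<close> of the mean of \<open>n\<close> independent coin tosses with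
  success probability \<open>x\<close>. It is what makes Bernstein averages localise at \<open>x\<close>.
\<close>

lemma sum_Bernstein_variance_le:
  assumes "0 \<le> x" "x \<le> 1" "0 < n"
  shows "(\<Sum>k\<le>n. (real k / n - x)\<^sup>2 * Bernstein n k x) \<le> 1 / n"
proof -
  have split: "(u - v)\<^sup>2 * w = u * (u - 1) * w + (1 - 2 * v) * u * w + v * v * w" for u v w :: real
    by (simp add: algebra_simps power2_eq_square)
  have "(\<Sum>k\<le>n. (real k - n * x)\<^sup>2 * Bernstein n k x) = n * x * (1 - x)"
    apply (simp add: split sum.distrib)
    apply (simp flip: sum_distrib_left add: mult.assoc)
    apply (simp add: algebra_simps power2_eq_square)
    done
  then have "(\<Sum>k\<le>n. (real k - n * x)\<^sup>2 * Bernstein n k x) / n\<^sup>2 = x * (1 - x) / n"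
    by (simp add: power2_eq_square)
  moreover have "(\<Sum>k\<le>n. (real k / n - x)\<^sup>2 * Bernstein n k x)
      = (\<Sum>k\<le>n. (real k - n * x)\<^sup>2 * Bernstein n k x) / n\<^sup>2"
    unfolding sum_divide_distrib
  proof (rule sum.cong[OF refl])
    fix k
    have "real k / n - x = (real k - n * x) / n"
      using assms by (simp add: field_simps)
    then show "(real k / n - x)\<^sup>2 * Bernstein n k x = (real k - n * x)\<^sup>2 * Bernstein n k x / n\<^sup>2"
      by (simp add: power_divide)
  qed
  moreover have "x * (1 - x) \<le> 1 * 1"
    using assms by (intro mult_mono) auto
  ultimately show ?thesis
    using assms by (simp add: divide_right_mono)
qed

text \<open>
  The hypothesis with a quadratic error term is what uniform continuity gives once jumps over
  large distances are charged to the square of the distance. Averaging turns the square into the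
  variance, so the bound is uniform in \<open>x\<close> and in any further parameter of \<open>v\<close>.
\<close>

lemma Bernstein_average_close:
  fixes v :: "nat \<Rightarrow> 'b::real_normed_vector"
  assumes x: "0 \<le> x" "x \<le> 1" and n: "0 < n" and C: "0 \<le> C"
    and v: "\<And>k. k \<le> n \<Longrightarrow> norm (v k - m) \<le> e + C * (real k / n - x)\<^sup>2"
  shows "norm ((\<Sum>k\<le>n. Bernstein n k x *\<^sub>R v k) - m) \<le> e + C / n"
proof -
  have "(\<Sum>k\<le>n. Bernstein n k x *\<^sub>R v k) - m = (\<Sum>k\<le>n. Bernstein n k x *\<^sub>R (v k - m))"
    by (simp add: scaleR_right_diff_distrib sum_subtractf flip: scaleR_left.sum)
  also have "norm \<dots> \<le> (\<Sum>k\<le>n. Bernstein n k x * (e + C * (real k / n - x)\<^sup>2))"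
    by (rule sum_norm_le) (use x v Bernstein_nonneg[OF x] in \<open>auto intro!: mult_left_mono\<close>)
  also have "\<dots> = e * (\<Sum>k\<le>n. Bernstein n k x)
      + C * (\<Sum>k\<le>n. (real k / n - x)\<^sup>2 * Bernstein n k x)"
    unfolding sum_distrib_left sum.distrib[symmetric]
    by (rule sum.cong) (auto simp: algebra_simps)
  also have "\<dots> = e + C * (\<Sum>k\<le>n. (real k / n - x)\<^sup>2 * Bernstein n k x)"
    by simp
  also have "\<dots> \<le> e + C * (1 / n)"
    using sum_Bernstein_variance_le[OF x n] C by (simp only: add_left_mono mult_left_mono)
  finally show ?thesis by simp
qed

lemma DERIV_one_minus_power:
  "((\<lambda>x. (1 - x) ^ m) has_real_derivative - (real m * (1 - x) ^ (m - 1))) (at x)"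
  by (rule DERIV_cong[OF DERIV_power]) (auto intro!: derivative_eq_intros)

lemma Bernstein_Suc_0_DERIV:
  "(Bernstein (Suc n) 0 has_real_derivative - real (Suc n) * Bernstein n 0 x) (at x)"
  using DERIV_one_minus_power[of "Suc n" x] unfolding Bernstein_def by (simp add: algebra_simps)

lemma Bernstein_Suc_Suc_DERIV:
  assumes "k \<le> n"
  shows "(Bernstein (Suc n) (Suc k) has_real_derivative
          real (Suc n) * (Bernstein n k x - Bernstein n (Suc k) x)) (at x)"
proof -
  have bin1: "real (Suc n choose Suc k) * real (Suc k) = real (Suc n) * real (n choose k)"
    by (metis Suc_times_binomial mult.commute of_nat_mult)
  have bin2: "real (Suc n choose Suc k) * real (n - k) = real (Suc n) * real (n choose Suc k)"
  proof (cases "k = n")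
    case False
    with assms have "k < n" by simp
    then have "(n - k) * (Suc n choose Suc k) = Suc n * (n choose Suc k)"
      using binomial_absorb_comp[of "Suc n" "Suc k"] by simp
    then show ?thesis
      by (metis mult.commute of_nat_mult)
  qed simp
  have pow: "((\<lambda>x. x ^ Suc k) has_real_derivative real (Suc k) * x ^ k) (at x)"
    using DERIV_pow[of "Suc k" x] by simp
  have "((\<lambda>x. real (Suc n choose Suc k) * (x ^ Suc k * (1 - x) ^ (n - k))) has_real_derivative
     real (Suc n choose Suc k) * (real (Suc k) * x ^ k * (1 - x) ^ (n - k)
       + - (real (n - k) * (1 - x) ^ (n - k - 1)) * x ^ Suc k)) (at x)"
    by (intro DERIV_cmult DERIV_mult pow DERIV_one_minus_power)
  moreover have "real (Suc n choose Suc k) * (real (Suc k) * x ^ k * (1 - x) ^ (n - k)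
       + - (real (n - k) * (1 - x) ^ (n - k - 1)) * x ^ Suc k)
     = real (Suc n choose Suc k) * real (Suc k) * (x ^ k * (1 - x) ^ (n - k))
     - real (Suc n choose Suc k) * real (n - k) * (x ^ Suc k * (1 - x) ^ (n - Suc k))"
  proof -
    have "a * (b * c * d + - (r * p) * q) = a * b * (c * d) - a * r * (q * p)"
      for a b c d r p q :: real
      by (simp add: algebra_simps)
    moreover have "n - k - 1 = n - Suc k" by simp
    ultimately show ?thesis by metis
  qed
  ultimately have "(Bernstein (Suc n) (Suc k) has_real_derivative
     real (Suc n choose Suc k) * real (Suc k) * (x ^ k * (1 - x) ^ (n - k))
     - real (Suc n choose Suc k) * real (n - k) * (x ^ Suc k * (1 - x) ^ (n - Suc k))) (at x)"
    unfolding Bernstein_def by (simp only: mult.assoc diff_Suc_Suc)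
  then show ?thesis
    unfolding bin1 bin2 by (simp add: Bernstein_def algebra_simps)
qed

text \<open>
  Summation by parts: differentiating a Bernstein polynomial takes differences of its
  coefficients and lowers the degree by one.
\<close>

lemma Bernstein_sum_DERIV:
  "((\<lambda>x. \<Sum>k\<le>Suc n. c k * Bernstein (Suc n) k x) has_real_derivative
    (\<Sum>k\<le>n. real (Suc n) * (c (Suc k) - c k) * Bernstein n k x)) (at x)"
proof -
  have "((\<lambda>x. c 0 * Bernstein (Suc n) 0 x + (\<Sum>k\<le>n. c (Suc k) * Bernstein (Suc n) (Suc k) x))
     has_real_derivative
     c 0 * (- real (Suc n) * Bernstein n 0 x)
     + (\<Sum>k\<le>n. c (Suc k) * (real (Suc n) * (Bernstein n k x - Bernstein n (Suc k) x)))) (at x)"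
    by (intro DERIV_add DERIV_sum DERIV_cmult Bernstein_Suc_0_DERIV Bernstein_Suc_Suc_DERIV) auto
  moreover have "(\<Sum>k\<le>n. c (Suc k) * Bernstein n (Suc k) x) + c 0 * Bernstein n 0 x
      = (\<Sum>k\<le>n. c k * Bernstein n k x)"
  proof -
    have "Bernstein n (Suc n) x = 0"
      by (simp add: Bernstein_def)
    then show ?thesis
      using sum.atMost_Suc_shift[of "\<lambda>k. c k * Bernstein n k x" n] by (simp add: add.commute)
  qed
  then have "c 0 * (- real (Suc n) * Bernstein n 0 x)
     + (\<Sum>k\<le>n. c (Suc k) * (real (Suc n) * (Bernstein n k x - Bernstein n (Suc k) x)))
     = (\<Sum>k\<le>n. real (Suc n) * (c (Suc k) - c k) * Bernstein n k x)"
  proof -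
    assume eq: "(\<Sum>k\<le>n. c (Suc k) * Bernstein n (Suc k) x) + c 0 * Bernstein n 0 x
      = (\<Sum>k\<le>n. c k * Bernstein n k x)"
    have "(\<Sum>k\<le>n. c (Suc k) * (real (Suc n) * (Bernstein n k x - Bernstein n (Suc k) x)))
       = real (Suc n) * ((\<Sum>k\<le>n. c (Suc k) * Bernstein n k x)
           - (\<Sum>k\<le>n. c (Suc k) * Bernstein n (Suc k) x))"
      unfolding sum_subtractf[symmetric] sum_distrib_left
      by (rule sum.cong) (auto simp: algebra_simps)
    moreover have "(\<Sum>k\<le>n. real (Suc n) * (c (Suc k) - c k) * Bernstein n k x)
       = real (Suc n) * ((\<Sum>k\<le>n. c (Suc k) * Bernstein n k x) - (\<Sum>k\<le>n. c k * Bernstein n k x))"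
      unfolding sum_subtractf[symmetric] sum_distrib_left
      by (rule sum.cong) (auto simp: algebra_simps)
    ultimately show ?thesis
      unfolding eq[symmetric] by (simp only: algebra_simps)
  qed
  ultimately show ?thesis
    unfolding sum.atMost_Suc_shift by simp
qed

text \<open>
  The sum is the derivative at \<open>x\<close> of the Bernstein polynomial of \<open>\<phi>\<close> of degree \<open>n + 1\<close>, see
  \<open>Bernstein_sum_DERIV\<close>. By the mean value theorem each difference quotient is a value of \<open>\<phi>'\<close>
  within \<open>1 / (n + 1)\<close> of the node \<open>k / n\<close>, so the average is close to \<open>\<phi>'\<close> near \<open>x\<close>.
\<close>

lemma Bernstein_difference_quotients_close:
  fixes \<phi> \<phi>' :: "real \<Rightarrow> real"
  assumes x: "0 \<le> x" "x \<le> 1" and n: "0 < n" and C: "0 \<le> C"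
    and der: "\<And>c. c \<in> {0..1} \<Longrightarrow> (\<phi> has_real_derivative \<phi>' c) (at c within {0..1})"
    and close: "\<And>c. c \<in> {0..1} \<Longrightarrow> \<bar>\<phi>' c - m\<bar> \<le> e + C * (c - x)\<^sup>2"
  shows "\<bar>(\<Sum>k\<le>n. real (Suc n) * (\<phi> (real (Suc k) / Suc n) - \<phi> (real k / Suc n)) * Bernstein n k x)
            - m\<bar> \<le> e + 4 * C / n"
proof -
  define v where "v k = real (Suc n) * (\<phi> (real (Suc k) / Suc n) - \<phi> (real k / Suc n))" for k
  have v: "norm (v k - m) \<le> (e + 2 * C / n) + 2 * C * (real k / n - x)\<^sup>2" if k: "k \<le> n" for k
  proof -
    let ?l = "real k / Suc n" and ?u = "real (Suc k) / Suc n"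
    have lu: "?l < ?u"
      by (rule divide_strict_right_mono) auto
    have l0: "0 \<le> ?l" and u1: "?u \<le> 1"
      using k by auto
    have "continuous_on {0..1} \<phi>"
      using der by (meson DERIV_continuous continuous_on_eq_continuous_within)
    then have "continuous_on {?l..?u} \<phi>"
      by (rule continuous_on_subset) (use l0 u1 in auto)
    moreover have "(\<phi> has_derivative (\<lambda>h. \<phi>' c * h)) (at c)" if "?l < c" "c < ?u" for c
    proof -
      have "0 < c" "c < 1" using that l0 u1 by linarith+
      then have "(\<phi> has_real_derivative \<phi>' c) (at c)"
        using der[of c] by (auto simp: at_within_Icc_at)
      then show ?thesis by (simp add: has_field_derivative_def)
    qed
    ultimately obtain \<zeta> where \<zeta>: "?l < \<zeta>" "\<zeta> < ?u" "\<phi> ?u - \<phi> ?l = \<phi>' \<zeta> * (?u - ?l)"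
      using mvt[OF lu, of \<phi> "\<lambda>c h. \<phi>' c * h"] by auto
    have "?u - ?l = 1 / Suc n"
      by (simp add: diff_divide_distrib[symmetric])
    then have vk: "v k = \<phi>' \<zeta>"
      unfolding v_def using \<zeta>(3) by simp
    have z01: "\<zeta> \<in> {0..1}"
      using \<zeta>(1,2) l0 u1 unfolding atLeastAtMost_iff by linarith
    \<comment> \<open>The node of the lower degree lies in the same interval as the intermediate point.\<close>
    have kn: "?l \<le> real k / n" "real k / n \<le> ?u"
    proof -
      show "?l \<le> real k / n"
        using n by (intro divide_left_mono) auto
      have "real k * real (Suc n) \<le> real (Suc k) * real n"
        using k by (simp add: algebra_simps)
      then show "real k / n \<le> ?u"
        using n by (subst frac_le_eq) (auto simp: divide_simps mult.commute)
    qed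
    have "\<bar>\<zeta> - real k / n\<bar> \<le> 1 / Suc n"
      using \<zeta>(1,2) kn \<open>?u - ?l = 1 / Suc n\<close> by linarith
    then have "(\<zeta> - real k / n)\<^sup>2 \<le> (1 / Suc n)\<^sup>2"
      by (metis abs_ge_zero power2_abs power_mono)
    also have "\<dots> \<le> 1 / n"
    proof -
      have "(1 / real (Suc n))\<^sup>2 \<le> 1 / Suc n"
        by (simp add: power2_eq_square divide_simps)
      also have "\<dots> \<le> 1 / n"
        using n by (intro divide_left_mono) auto
      finally show ?thesis .
    qed
    finally have near: "(\<zeta> - real k / n)\<^sup>2 \<le> 1 / n" .
    have "(\<zeta> - x)\<^sup>2 \<le> 2 * (\<zeta> - real k / n)\<^sup>2 + 2 * (real k / n - x)\<^sup>2"
    proof -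
      have "(a + b)\<^sup>2 \<le> 2 * a\<^sup>2 + 2 * b\<^sup>2" for a b :: real
        using zero_le_power2[of "a - b"] unfolding power2_sum power2_diff by linarith
      from this[of "\<zeta> - real k / n" "real k / n - x"] show ?thesis by simp
    qed
    also have "\<dots> \<le> 2 * (1 / n) + 2 * (real k / n - x)\<^sup>2"
      using near by linarith
    finally have "C * (\<zeta> - x)\<^sup>2 \<le> C * (2 * (1 / n) + 2 * (real k / n - x)\<^sup>2)"
      using C by (rule mult_left_mono)
    with close[OF z01] show ?thesis
      unfolding vk real_norm_def by (simp add: algebra_simps)
  qed
  have "norm ((\<Sum>k\<le>n. Bernstein n k x *\<^sub>R v k) - m) \<le> (e + 2 * C / n) + 2 * C / n"
    by (rule Bernstein_average_close[OF x n _ v]) (use C in auto)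
  then show ?thesis
    by (simp add: v_def mult.commute)
qed

lemma DERIV_Bernstein_explicit:
  "(Bernstein m k has_real_derivative
      of_nat (m choose k) * (real k * x ^ (k - 1)) * (1 - x) ^ (m - k)
      + - (real (m - k) * (1 - x) ^ (m - k - 1)) * (of_nat (m choose k) * x ^ k)) (at x)"
proof -
  have "((\<lambda>x. x ^ k) has_real_derivative real k * x ^ (k - 1)) (at x)"
    using DERIV_pow[of k x] by simp
  then show ?thesis
    unfolding Bernstein_def[abs_def] by (intro DERIV_mult DERIV_cmult DERIV_one_minus_power)
qed

lemma DERIV_Bernstein: "(Bernstein m k has_real_derivative deriv (Bernstein m k) x) (at x)"
  using DERIV_Bernstein_explicit[of m k x] DERIV_imp_deriv[OF DERIV_Bernstein_explicit[of m k x]]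
  by simp

lemma continuous_on_deriv_Bernstein: "continuous_on S (deriv (Bernstein m k))"
proof -
  have "deriv (Bernstein m k) = (\<lambda>x. of_nat (m choose k) * (real k * x ^ (k - 1)) * (1 - x) ^ (m - k)
      + - (real (m - k) * (1 - x) ^ (m - k - 1)) * (of_nat (m choose k) * x ^ k))"
    by (rule ext) (rule DERIV_imp_deriv[OF DERIV_Bernstein_explicit])
  then show ?thesis
    by (simp only:) (intro continuous_intros)
qed

text \<open>
  Points closer than the \<open>d\<close> of uniform continuity contribute at most \<open>e\<close>; for all others the
  oscillation of \<open>g\<close>, at most \<open>2 M\<close>, is absorbed by \<open>2 M (dist / d)\<^sup>2\<close>.
\<close>

lemma continuous_on_compact_quadratic_modulus:
  fixes g :: "'a::real_normed_vector \<Rightarrow> 'b::real_normed_vector"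
  assumes "compact B" "continuous_on B g" "0 < e"
  obtains C where "0 \<le> C" "\<And>x y. x \<in> B \<Longrightarrow> y \<in> B \<Longrightarrow> norm (g x - g y) \<le> e + C * (norm (x - y))\<^sup>2"
proof -
  obtain d where d: "0 < d" "\<And>x y. x \<in> B \<Longrightarrow> y \<in> B \<Longrightarrow> dist y x < d \<Longrightarrow> dist (g y) (g x) < e"
    using compact_uniformly_continuous[OF assms(2,1)] \<open>0 < e\<close>
    unfolding uniformly_continuous_on_def by blast
  obtain M where M: "0 < M" "\<And>x. x \<in> B \<Longrightarrow> norm (g x) \<le> M"
    using compact_imp_bounded[OF compact_continuous_image[OF assms(2,1)]]
    unfolding bounded_pos by auto
  show ?thesis
  proof (rule that[of "2 * M / d\<^sup>2"])
    fix x y assume xy: "x \<in> B" "y \<in> B"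
    show "norm (g x - g y) \<le> e + 2 * M / d\<^sup>2 * (norm (x - y))\<^sup>2"
    proof (cases "dist x y < d")
      case True
      then have "norm (g x - g y) < e"
        using d(2)[of y x] xy by (simp add: dist_norm)
      moreover have "0 \<le> 2 * M / d\<^sup>2 * (norm (x - y))\<^sup>2"
        using M by simp
      ultimately show ?thesis by linarith
    next
      case False
      then have "d\<^sup>2 \<le> (norm (x - y))\<^sup>2"
        using d(1) by (intro power_mono) (auto simp: dist_norm)
      then have "1 \<le> (norm (x - y))\<^sup>2 / d\<^sup>2"
        using d(1) by simp
      then have "2 * M * 1 \<le> 2 * M * ((norm (x - y))\<^sup>2 / d\<^sup>2)"
        using M(1) by (intro mult_left_mono) auto
      moreover have "norm (g x - g y) \<le> 2 * M"
        using norm_triangle_ineq4[of "g x" "g y"] M(2)[OF xy(1)] M(2)[OF xy(2)] by linarith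
      ultimately show ?thesis
        using \<open>0 < e\<close> by (simp add: field_simps)
    qed
  qed (use M in auto)
qed

section \<open>Polynomials are dense in \<open>C\<^sup>1\<close>\<close>

text \<open>
  Approximability of the pair \<open>(f, G)\<close> on \<open>B\<close> in the \<open>C\<^sup>1\<close> norm. The gradient is a separate argument
  because \<open>f\<close> matters only on \<open>B\<close>, where at boundary points it has at best a derivative within \<open>B\<close>.
\<close>

definition poly_C1_approximable ::
    "'a::euclidean_space set \<Rightarrow> ('a \<Rightarrow> real) \<Rightarrow> ('a \<Rightarrow> 'a) \<Rightarrow> bool" where
  "poly_C1_approximable B f G \<longleftrightarrow>
     (\<forall>e>0. \<exists>p p'. real_polynomial_function p \<and> (\<forall>x. GDERIV p x :> p' x) \<and>
        (\<forall>x\<in>B. \<bar>p x - f x\<bar> \<le> e \<and> norm (p' x - G x) \<le> e))"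

lemma poly_C1_approximable_const: "poly_C1_approximable B (\<lambda>x. c) (\<lambda>x. 0)"
  unfolding poly_C1_approximable_def
proof (intro allI impI exI conjI)
  show "real_polynomial_function (\<lambda>x. c)"
    by (rule real_polynomial_function.intros)
  show "GDERIV (\<lambda>x. c) x :> 0" for x :: 'a
    by (rule GDERIV_const)
qed auto

lemma poly_C1_approximable_cong:
  assumes "poly_C1_approximable B f G" "\<And>x. x \<in> B \<Longrightarrow> f x = g x" "\<And>x. x \<in> B \<Longrightarrow> G x = H x"
  shows "poly_C1_approximable B g H"
  using assms(1) unfolding poly_C1_approximable_def by (simp add: assms(2,3) cong: ball_cong_simp)

lemma poly_C1_approximable_add:
  assumes "poly_C1_approximable B f G" "poly_C1_approximable B g H"
  shows "poly_C1_approximable B (\<lambda>x. f x + g x) (\<lambda>x. G x + H x)"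
  unfolding poly_C1_approximable_def
proof (intro allI impI)
  fix e :: real assume "e > 0"
  then have e2: "e / 2 > 0" by simp
  obtain p p' where p: "real_polynomial_function p" "\<And>x. GDERIV p x :> p' x"
      "\<And>x. x \<in> B \<Longrightarrow> \<bar>p x - f x\<bar> \<le> e / 2 \<and> norm (p' x - G x) \<le> e / 2"
    using assms(1) e2 unfolding poly_C1_approximable_def by metis
  obtain q q' where q: "real_polynomial_function q" "\<And>x. GDERIV q x :> q' x"
      "\<And>x. x \<in> B \<Longrightarrow> \<bar>q x - g x\<bar> \<le> e / 2 \<and> norm (q' x - H x) \<le> e / 2"
    using assms(2) e2 unfolding poly_C1_approximable_def by metis
  have "norm ((p' x + q' x) - (G x + H x)) \<le> e" if "x \<in> B" for x
    using norm_diff_triangle_ineq[of "p' x" "q' x" "G x" "H x"] p(3)[OF that] q(3)[OF that]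
    by linarith
  moreover have "\<bar>(p x + q x) - (f x + g x)\<bar> \<le> e" if "x \<in> B" for x
    using p(3)[OF that] q(3)[OF that] by linarith
  ultimately show "\<exists>r r'. real_polynomial_function r \<and> (\<forall>x. GDERIV r x :> r' x) \<and>
      (\<forall>x\<in>B. \<bar>r x - (f x + g x)\<bar> \<le> e \<and> norm (r' x - (G x + H x)) \<le> e)"
    using p(1,2) q(1,2)
    by (intro exI[of _ "\<lambda>x. p x + q x"] exI[of _ "\<lambda>x. p' x + q' x"])
       (auto intro: GDERIV_add)
qed

lemma poly_C1_approximable_sum:
  assumes "finite I" "\<And>k. k \<in> I \<Longrightarrow> poly_C1_approximable B (f k) (G k)"
  shows "poly_C1_approximable B (\<lambda>x. \<Sum>k\<in>I. f k x) (\<lambda>x. \<Sum>k\<in>I. G k x)"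
  using assms
proof (induction I rule: finite_induct)
  case empty
  show ?case using poly_C1_approximable_const[of B 0] by simp
next
  case (insert j I)
  have "poly_C1_approximable B (\<lambda>x. f j x + (\<Sum>k\<in>I. f k x)) (\<lambda>x. G j x + (\<Sum>k\<in>I. G k x))"
    using insert by (intro poly_C1_approximable_add) auto
  with insert.hyps show ?case by simp
qed

text \<open>
  Only products with a fixed polynomial \<open>q\<close> are treated: the error is then linear in the error of
  the approximation of \<open>f\<close>.
\<close>

lemma poly_C1_approximable_mult_poly:
  assumes f: "poly_C1_approximable B f G"
    and q: "real_polynomial_function q" "\<And>x. GDERIV q x :> q' x"
    and M: "\<And>x. x \<in> B \<Longrightarrow> \<bar>q x\<bar> \<le> M" "\<And>x. x \<in> B \<Longrightarrow> norm (q' x) \<le> M"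
  shows "poly_C1_approximable B (\<lambda>x. f x * q x) (\<lambda>x. f x *\<^sub>R q' x + q x *\<^sub>R G x)"
  unfolding poly_C1_approximable_def
proof (intro allI impI)
  fix e :: real assume "e > 0"
  define M' where "M' = max M 1"
  have M': "M' > 0" "\<And>x. x \<in> B \<Longrightarrow> \<bar>q x\<bar> \<le> M'" "\<And>x. x \<in> B \<Longrightarrow> norm (q' x) \<le> M'"
    using M unfolding M'_def by force+
  define d where "d = e / (2 * M')"
  have d: "d > 0" "d * M' + d * M' = e"
    using \<open>e > 0\<close> M' by (auto simp: d_def)
  obtain p p' where p: "real_polynomial_function p" "\<And>x. GDERIV p x :> p' x"
      "\<And>x. x \<in> B \<Longrightarrow> \<bar>p x - f x\<bar> \<le> d \<and> norm (p' x - G x) \<le> d"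
    using f d(1) unfolding poly_C1_approximable_def by metis
  have "\<bar>p x * q x - f x * q x\<bar> \<le> e
      \<and> norm ((p x *\<^sub>R q' x + q x *\<^sub>R p' x) - (f x *\<^sub>R q' x + q x *\<^sub>R G x)) \<le> e" if "x \<in> B" for x
  proof
    have "\<bar>p x * q x - f x * q x\<bar> = \<bar>p x - f x\<bar> * \<bar>q x\<bar>"
      by (simp add: abs_mult[symmetric] algebra_simps)
    also have "\<dots> \<le> d * M'"
      using p(3) M' d that by (intro mult_mono) auto
    also have "\<dots> \<le> e"
      using d M'(1) mult_pos_pos[OF d(1) M'(1)] by linarith
    finally show "\<bar>p x * q x - f x * q x\<bar> \<le> e" .
    have "(p x *\<^sub>R q' x + q x *\<^sub>R p' x) - (f x *\<^sub>R q' x + q x *\<^sub>R G x)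
        = (p x - f x) *\<^sub>R q' x + q x *\<^sub>R (p' x - G x)"
      by (simp add: algebra_simps)
    also have "norm \<dots> \<le> \<bar>p x - f x\<bar> * norm (q' x) + \<bar>q x\<bar> * norm (p' x - G x)"
      by (metis norm_scaleR norm_triangle_ineq)
    also have "\<dots> \<le> d * M' + M' * d"
      using p(3) M' d that by (intro add_mono mult_mono) auto
    also have "\<dots> = e"
      using d(2) by (simp add: mult.commute)
    finally show "norm ((p x *\<^sub>R q' x + q x *\<^sub>R p' x) - (f x *\<^sub>R q' x + q x *\<^sub>R G x)) \<le> e" .
  qed
  then show "\<exists>r r'. real_polynomial_function r \<and> (\<forall>x. GDERIV r x :> r' x) \<and>
      (\<forall>x\<in>B. \<bar>r x - f x * q x\<bar> \<le> e \<and> norm (r' x - (f x *\<^sub>R q' x + q x *\<^sub>R G x)) \<le> e)"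
    using p(1,2) q
    by (intro exI[of _ "\<lambda>x. p x * q x"] exI[of _ "\<lambda>x. p x *\<^sub>R q' x + q x *\<^sub>R p' x"])
       (auto intro: GDERIV_mult)
qed

lemma poly_C1_approximable_limit:
  assumes "\<And>e. e > 0 \<Longrightarrow> \<exists>g H. poly_C1_approximable B g H \<and>
             (\<forall>x\<in>B. \<bar>g x - f x\<bar> \<le> e \<and> norm (H x - G x) \<le> e)"
  shows "poly_C1_approximable B f G"
  unfolding poly_C1_approximable_def
proof (intro allI impI)
  fix e :: real assume "e > 0"
  then have e2: "e / 2 > 0" by simp
  obtain g H where g: "poly_C1_approximable B g H"
      "\<And>x. x \<in> B \<Longrightarrow> \<bar>g x - f x\<bar> \<le> e / 2 \<and> norm (H x - G x) \<le> e / 2"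
    using assms[OF e2] by blast
  obtain p p' where p: "real_polynomial_function p" "\<And>x. GDERIV p x :> p' x"
      "\<And>x. x \<in> B \<Longrightarrow> \<bar>p x - g x\<bar> \<le> e / 2 \<and> norm (p' x - H x) \<le> e / 2"
    using g(1) e2 unfolding poly_C1_approximable_def by metis
  have "norm (p' x - G x) \<le> e" if "x \<in> B" for x
    using norm_triangle_ineq[of "p' x - H x" "H x - G x"] p(3)[OF that] g(2)[OF that] by simp
  moreover have "\<bar>p x - f x\<bar> \<le> e" if "x \<in> B" for x
    using p(3)[OF that] g(2)[OF that] by linarith
  ultimately show "\<exists>p p'. real_polynomial_function p \<and> (\<forall>x. GDERIV p x :> p' x) \<and>
        (\<forall>x\<in>B. \<bar>p x - f x\<bar> \<le> e \<and> norm (p' x - G x) \<le> e)"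
    using p(1,2) by blast
qed

text \<open>
  One coordinate \<open>i\<close> is treated with the Bernstein operator, the others are frozen. The result is
  \<open>\<Sum>\<^sub>k f\<^sub>k(x) b\<^sub>k(x\<^sub>i)\<close>, where the slice \<open>f\<^sub>k\<close> is \<open>f\<close> with its coordinate \<open>i\<close> set to the \<open>k\<close>-th node. By
  assumption slices are approximable, hence so is the sum. It converges to \<open>f\<close> in \<open>C\<^sup>1\<close>:
  its derivatives in directions orthogonal to \<open>i\<close> are Bernstein averages of those of \<open>f\<close>,
  and its derivative in direction \<open>i\<close> is a Bernstein average of difference quotients.
\<close>

lemma poly_C1_approximable_Bernstein_step:
  fixes f :: "'a::euclidean_space \<Rightarrow> real" and G :: "'a \<Rightarrow> 'a"
  assumes box: "\<And>i. i \<in> Basis \<Longrightarrow> a \<bullet> i < b \<bullet> i"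
    and i: "i \<in> Basis"
    and G: "continuous_on (cbox a b) G"
    and der: "\<And>x. x \<in> cbox a b \<Longrightarrow> (f has_derivative (\<lambda>h. h \<bullet> G x)) (at x within cbox a b)"
    and slices: "\<And>c. c \<in> {0..1} \<Longrightarrow>
       poly_C1_approximable (cbox a b)
         (\<lambda>x. f (x + (a \<bullet> i + c * (b \<bullet> i - a \<bullet> i) - x \<bullet> i) *\<^sub>R i))
         (\<lambda>x. G (x + (a \<bullet> i + c * (b \<bullet> i - a \<bullet> i) - x \<bullet> i) *\<^sub>R i)
              - (G (x + (a \<bullet> i + c * (b \<bullet> i - a \<bullet> i) - x \<bullet> i) *\<^sub>R i) \<bullet> i) *\<^sub>R i)"
  shows "poly_C1_approximable (cbox a b) f G"
proof (rule poly_C1_approximable_limit)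
  fix \<epsilon> :: real assume "\<epsilon> > 0"
  define B where "B = cbox a b"
  define w where "w = b \<bullet> i - a \<bullet> i"
  have w: "w > 0" using box[OF i] by (simp add: w_def)
  \<comment> \<open>Coordinate \<open>i\<close> is moved to the relative position \<open>c \<in> [0,1]\<close>; \<open>s x\<close> is the relative position of \<open>x\<close>.\<close>
  define mv where "mv c x = x + (a \<bullet> i + c * w - x \<bullet> i) *\<^sub>R i" for c x
  define s where "s x = (x \<bullet> i - a \<bullet> i) / w" for x
  have s01: "0 \<le> s x" "s x \<le> 1" if "x \<in> B" for x
    using that i w by (auto simp: s_def B_def mem_box w_def)
  have mv_B: "mv c x \<in> B" if "c \<in> {0..1}" "x \<in> B" for c x
  proof -
    have "0 \<le> c * w" "c * w \<le> 1 * w"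
      using that(1) w by (auto intro: mult_right_mono)
    then show ?thesis
      using that(2) i by (auto simp: mv_def B_def mem_box inner_add_left inner_Basis w_def)
  qed
  have mv_diff: "mv c x - x = (w * (c - s x)) *\<^sub>R i" for c x
  proof -
    have "a \<bullet> i + c * w - x \<bullet> i = w * (c - s x)"
      using w by (simp add: s_def field_simps)
    then show ?thesis by (simp add: mv_def)
  qed
  then have mv_dist: "(norm (mv c x - x))\<^sup>2 = w\<^sup>2 * (c - s x)\<^sup>2" for c x
    using i by (simp add: power_mult_distrib)
  have fcont: "continuous_on B f"
    unfolding B_def by (rule has_derivative_continuous_on[OF der])
  \<comment> \<open>The gradient error below consists of \<open>3 \<eta>\<close> from the modulus of continuity and \<open>6 C w\<^sup>2 / n\<close> from the variance.\<close>
  define \<eta> where "\<eta> = \<epsilon> / 4"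
  have \<eta>: "\<eta> > 0" using \<open>\<epsilon> > 0\<close> by (simp add: \<eta>_def)
  have "continuous_on B (\<lambda>x. (f x, G x))"
    using fcont G by (auto simp: B_def intro!: continuous_intros)
  then obtain C where C: "0 \<le> C" and modulus:
    "\<And>x y. x \<in> B \<Longrightarrow> y \<in> B \<Longrightarrow> norm ((f x, G x) - (f y, G y)) \<le> \<eta> + C * (norm (x - y))\<^sup>2"
    using continuous_on_compact_quadratic_modulus[of B "\<lambda>x. (f x, G x)" \<eta>] \<eta>
    by (auto simp: B_def)
  have f_close: "\<bar>f (mv c x) - f x\<bar> \<le> \<eta> + (C * w\<^sup>2) * (c - s x)\<^sup>2"
    and G_close: "norm (G (mv c x) - G x) \<le> \<eta> + (C * w\<^sup>2) * (c - s x)\<^sup>2"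
    if "c \<in> {0..1}" "x \<in> B" for c x
    using modulus[OF mv_B[OF that] that(2)]
      norm_fst_le[of "f (mv c x) - f x" "G (mv c x) - G x"]
      norm_snd_le[of "G (mv c x) - G x" "f (mv c x) - f x"]
    by (simp_all add: mv_dist mult.assoc)
  \<comment> \<open>The component orthogonal to \<open>i\<close>, which is the gradient of a slice.\<close>
  define Q where "Q v = v - (v \<bullet> i) *\<^sub>R i" for v
  have Q_norm: "norm (Q v) \<le> 2 * norm v" for v
  proof -
    have "norm (Q v) \<le> norm v + \<bar>v \<bullet> i\<bar>"
      unfolding Q_def using norm_triangle_ineq4[of v "(v \<bullet> i) *\<^sub>R i"] i by simp
    then show ?thesis using Basis_le_norm[OF i, of v] by linarith
  qed
  have Q_diff: "Q u - Q v = Q (u - v)" for u v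
    by (simp add: Q_def inner_diff_left scaleR_diff_left)
  obtain n :: nat where n: "n > 0" "6 * (C * w\<^sup>2) / n \<le> \<eta>"
  proof -
    obtain m :: nat where m: "6 * (C * w\<^sup>2) / \<eta> < m"
      using reals_Archimedean2 by blast
    have "6 * (C * w\<^sup>2) / \<eta> \<le> Suc m" using m by simp
    then have "6 * (C * w\<^sup>2) / Suc m \<le> \<eta>"
      using \<eta> by (simp add: divide_le_eq mult.commute)
    then show ?thesis using that[of "Suc m"] by simp
  qed
  let ?N = "Suc n"
  define node where "node k = real k / real ?N" for k
  have node: "node k \<in> {0..1}" if "k \<le> ?N" for k
    using that by (auto simp: node_def)
  define g where "g x = (\<Sum>k\<le>?N. f (mv (node k) x) * Bernstein ?N k (s x))" for x
  define H where "H x = (\<Sum>k\<le>?N. f (mv (node k) x) *\<^sub>R ((deriv (Bernstein ?N k) (s x) / w) *\<^sub>R i)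
      + Bernstein ?N k (s x) *\<^sub>R Q (G (mv (node k) x)))" for x
  have H_eq: "H x = (\<Sum>k\<le>?N. Bernstein ?N k (s x) *\<^sub>R Q (G (mv (node k) x)))
     + ((\<Sum>k\<le>n. real ?N * (f (mv (node (Suc k)) x) - f (mv (node k) x)) * Bernstein n k (s x)) / w) *\<^sub>R i"
    for x
  proof -
    have "((\<lambda>y. \<Sum>k\<le>?N. f (mv (node k) x) * Bernstein ?N k y) has_real_derivative
        (\<Sum>k\<le>?N. f (mv (node k) x) * deriv (Bernstein ?N k) (s x))) (at (s x))"
      by (intro DERIV_sum DERIV_cmult DERIV_Bernstein)
    then have "(\<Sum>k\<le>?N. f (mv (node k) x) * deriv (Bernstein ?N k) (s x))
       = (\<Sum>k\<le>n. real ?N * (f (mv (node (Suc k)) x) - f (mv (node k) x)) * Bernstein n k (s x))"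
      using Bernstein_sum_DERIV by (rule DERIV_unique)
    moreover have "H x = (\<Sum>k\<le>?N. Bernstein ?N k (s x) *\<^sub>R Q (G (mv (node k) x)))
       + ((\<Sum>k\<le>?N. f (mv (node k) x) * deriv (Bernstein ?N k) (s x)) / w) *\<^sub>R i"
      unfolding H_def sum.distrib by (simp add: scaleR_left.sum sum_divide_distrib del: sum.atMost_Suc)
    ultimately show ?thesis by (simp only: add.commute)
  qed
  have approx: "poly_C1_approximable B g H"
    unfolding g_def[abs_def] H_def[abs_def]
  proof (rule poly_C1_approximable_sum)
    fix k assume "k \<in> {..?N}"
    then have k: "k \<le> ?N" by simp
    let ?q = "\<lambda>x. Bernstein ?N k (s x)"
    let ?q' = "\<lambda>x. (deriv (Bernstein ?N k) (s x) / w) *\<^sub>R i"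
    have s_poly: "real_polynomial_function s"
      unfolding s_def[abs_def]
      by (intro real_polynomial_function_divide real_polynomial_function_diff
            real_polynomial_function.intros(1)[OF bounded_linear_inner_left]
            real_polynomial_function.intros(2))
    then have q_poly: "real_polynomial_function ?q"
      unfolding Bernstein_def[abs_def]
      by (intro real_polynomial_function.intros(2,4) real_polynomial_function_power
            real_polynomial_function_diff)
    have q_grad: "GDERIV ?q x :> ?q' x" for x
    proof -
      have "GDERIV s x :> (1 / w) *\<^sub>R i"
        unfolding gderiv_def s_def using w by (auto intro!: derivative_eq_intros)
      from GDERIV_DERIV_compose[OF this DERIV_Bernstein[of ?N k "s x"]]
      have "GDERIV ?q x :> deriv (Bernstein ?N k) (s x) *\<^sub>R (1 / w) *\<^sub>R i" .
      then show ?thesis by (simp only: scaleR_scaleR times_divide_eq_right mult_1_right)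
    qed
    have s_cont: "continuous_on B s"
      unfolding s_def[abs_def] using w by (intro continuous_intros) auto
    have "continuous_on B ?q'"
      using w by (intro continuous_intros continuous_on_compose2[OF continuous_on_deriv_Bernstein s_cont])
         auto
    then have "bounded (?q' ` B)"
      by (simp add: B_def compact_continuous_image compact_imp_bounded)
    then obtain M1 where M1: "\<And>x. x \<in> B \<Longrightarrow> norm (?q' x) \<le> M1"
      unfolding bounded_iff by blast
    have "continuous_on B ?q"
      unfolding Bernstein_def by (intro continuous_intros s_cont)
    then have "bounded (?q ` B)"
      by (simp add: B_def compact_continuous_image compact_imp_bounded)
    then obtain M2 where M2: "\<And>x. x \<in> B \<Longrightarrow> \<bar>?q x\<bar> \<le> M2"
      unfolding bounded_iff real_norm_def by blast
    have slice: "poly_C1_approximable B (\<lambda>x. f (mv (node k) x)) (\<lambda>x. Q (G (mv (node k) x)))"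
      using slices[OF node[OF k]] unfolding B_def w_def mv_def Q_def .
    show "poly_C1_approximable B (\<lambda>x. f (mv (node k) x) * ?q x)
        (\<lambda>x. f (mv (node k) x) *\<^sub>R ?q' x + ?q x *\<^sub>R Q (G (mv (node k) x)))"
      by (rule poly_C1_approximable_mult_poly[OF slice q_poly q_grad, where M = "max M1 M2"])
         (meson M1 M2 max.coboundedI1 max.coboundedI2)+
  qed simp
  have close: "\<bar>g x - f x\<bar> \<le> \<epsilon> \<and> norm (H x - G x) \<le> \<epsilon>" if x: "x \<in> B" for x
  proof
    have nN: "6 * (C * w\<^sup>2) / ?N \<le> \<eta>"
    proof -
      have "6 * (C * w\<^sup>2) / ?N \<le> 6 * (C * w\<^sup>2) / n"
        using n(1) C by (intro divide_left_mono) auto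
      with n(2) show ?thesis by linarith
    qed
    have pos: "0 \<le> C * w\<^sup>2 / ?N" "0 \<le> C * w\<^sup>2 / n"
      using C by auto
    have "norm ((\<Sum>k\<le>?N. Bernstein ?N k (s x) *\<^sub>R f (mv (node k) x)) - f x) \<le> \<eta> + C * w\<^sup>2 / ?N"
      by (rule Bernstein_average_close)
         (use s01[OF x] C f_close[OF node x] in \<open>auto simp: node_def\<close>)
    moreover have "(\<Sum>k\<le>?N. Bernstein ?N k (s x) *\<^sub>R f (mv (node k) x)) = g x"
      by (simp add: g_def mult.commute)
    ultimately have "\<bar>g x - f x\<bar> \<le> \<eta> + C * w\<^sup>2 / ?N" by simp
    then show "\<bar>g x - f x\<bar> \<le> \<epsilon>"
      using nN pos \<open>\<epsilon> > 0\<close> unfolding \<eta>_def by linarith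
    have tangential: "norm ((\<Sum>k\<le>?N. Bernstein ?N k (s x) *\<^sub>R Q (G (mv (node k) x))) - Q (G x))
        \<le> 2 * \<eta> + 2 * (C * w\<^sup>2) / ?N"
    proof (rule Bernstein_average_close)
      fix k assume k: "k \<le> ?N"
      have "norm (Q (G (mv (node k) x)) - Q (G x)) \<le> 2 * (\<eta> + (C * w\<^sup>2) * (node k - s x)\<^sup>2)"
        unfolding Q_diff using G_close[OF node[OF k] x]
        by (intro order_trans[OF Q_norm mult_left_mono]) auto
      then show "norm (Q (G (mv (node k) x)) - Q (G x))
          \<le> 2 * \<eta> + 2 * (C * w\<^sup>2) * (real k / real ?N - s x)\<^sup>2"
        by (simp add: node_def algebra_simps)
    qed (use s01[OF x] C in auto)
    have "\<bar>(\<Sum>k\<le>n. real ?N * (f (mv (real (Suc k) / ?N) x) - f (mv (real k / ?N) x)) * Bernstein n k (s x))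
            - w * (G x \<bullet> i)\<bar> \<le> w * \<eta> + 4 * (w * (C * w\<^sup>2)) / n"
    proof (rule Bernstein_difference_quotients_close)
      fix c :: real assume c: "c \<in> {0..1}"
      have "((\<lambda>c. mv c x) has_derivative (\<lambda>h. (h * w) *\<^sub>R i)) (at c within {0..1})"
        unfolding mv_def by (auto intro!: derivative_eq_intros)
      moreover have "(f has_derivative (\<lambda>h. h \<bullet> G (mv c x))) (at (mv c x) within (\<lambda>c. mv c x) ` {0..1})"
        using der[of "mv c x"] mv_B[OF _ x] c unfolding B_def
        by (auto intro: has_derivative_subset)
      ultimately have "((\<lambda>c. f (mv c x)) has_derivative (\<lambda>h. ((h * w) *\<^sub>R i) \<bullet> G (mv c x))) (at c within {0..1})"
        by (rule has_derivative_in_compose)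
      then show "((\<lambda>c. f (mv c x)) has_real_derivative w * (G (mv c x) \<bullet> i)) (at c within {0..1})"
        by (simp add: has_field_derivative_def inner_commute mult.commute mult.left_commute mult.assoc
             mult_commute_abs)
      have "\<bar>w * (G (mv c x) \<bullet> i) - w * (G x \<bullet> i)\<bar> = w * \<bar>(G (mv c x) - G x) \<bullet> i\<bar>"
        using w by (simp add: inner_diff_left abs_mult flip: right_diff_distrib)
      also have "\<dots> \<le> w * (\<eta> + (C * w\<^sup>2) * (c - s x)\<^sup>2)"
        using w G_close[OF c x] Basis_le_norm[OF i, of "G (mv c x) - G x"]
        by (intro mult_left_mono) auto
      finally show "\<bar>w * (G (mv c x) \<bullet> i) - w * (G x \<bullet> i)\<bar> \<le> w * \<eta> + w * (C * w\<^sup>2) * (c - s x)\<^sup>2"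
        by (simp add: algebra_simps)
    qed (use s01[OF x] n C w in auto)
    then have "\<bar>(\<Sum>k\<le>n. real ?N * (f (mv (node (Suc k)) x) - f (mv (node k) x)) * Bernstein n k (s x))
            - w * (G x \<bullet> i)\<bar> / w \<le> (w * \<eta> + 4 * (w * (C * w\<^sup>2)) / n) / w"
      unfolding node_def using w by (intro divide_right_mono) auto
    then have "\<bar>((\<Sum>k\<le>n. real ?N * (f (mv (node (Suc k)) x) - f (mv (node k) x)) * Bernstein n k (s x))
            - w * (G x \<bullet> i)) / w\<bar> \<le> \<eta> + 4 * (C * w\<^sup>2) / n"
      using w by (simp add: add_divide_distrib)
    then have normal: "\<bar>(\<Sum>k\<le>n. real ?N * (f (mv (node (Suc k)) x) - f (mv (node k) x)) * Bernstein n k (s x)) / w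
            - G x \<bullet> i\<bar> \<le> \<eta> + 4 * (C * w\<^sup>2) / n"
      using w by (simp add: diff_divide_distrib)
    define A where "A = (\<Sum>k\<le>?N. Bernstein ?N k (s x) *\<^sub>R Q (G (mv (node k) x)))"
    define d where "d = (\<Sum>k\<le>n. real ?N * (f (mv (node (Suc k)) x) - f (mv (node k) x))
        * Bernstein n k (s x)) / w"
    have "H x - G x = (A - Q (G x)) + (d - G x \<bullet> i) *\<^sub>R i"
      unfolding H_eq A_def[symmetric] d_def[symmetric] Q_def[of "G x"]
      by (simp add: scaleR_left_diff_distrib)
    also have "norm \<dots> \<le> norm (A - Q (G x)) + norm ((d - G x \<bullet> i) *\<^sub>R i)"
      by (rule norm_triangle_ineq)
    also have "\<dots> = norm (A - Q (G x)) + \<bar>d - G x \<bullet> i\<bar>"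
      using i by simp
    also have "\<dots> \<le> (2 * \<eta> + 2 * (C * w\<^sup>2) / ?N) + (\<eta> + 4 * (C * w\<^sup>2) / n)"
      using tangential normal unfolding A_def d_def by (rule add_mono)
    finally have "norm (H x - G x) \<le> 3 * \<eta> + 2 * (C * w\<^sup>2) / ?N + 4 * (C * w\<^sup>2) / n"
      by linarith
    moreover have "2 * (C * w\<^sup>2) / ?N \<le> 2 * (C * w\<^sup>2) / n"
      using n(1) C by (intro divide_left_mono) auto
    moreover have "2 * (C * w\<^sup>2) / n + 4 * (C * w\<^sup>2) / n = 6 * (C * w\<^sup>2) / n"
      by (simp only: add_divide_distrib[symmetric] distrib_right[symmetric]) simp
    ultimately show "norm (H x - G x) \<le> \<epsilon>"
      using n(2) unfolding \<eta>_def by linarith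
  qed
  show "\<exists>g H. poly_C1_approximable (cbox a b) g H \<and>
             (\<forall>x\<in>cbox a b. \<bar>g x - f x\<bar> \<le> \<epsilon> \<and> norm (H x - G x) \<le> \<epsilon>)"
    unfolding B_def[symmetric] by (rule exI[of _ g], rule exI[of _ H]) (simp add: approx close)
qed

text \<open>
  \<open>S\<close> contains the coordinates on which \<open>f\<close> depends, expressed through the gradient so that the
  empty case is the constancy of functions with zero derivative. A slice in direction \<open>i\<close> has a
  gradient without component \<open>i\<close>, so the induction hypothesis applies to it.
\<close>

lemma poly_C1_approximable_depending_on:
  fixes f :: "'a::euclidean_space \<Rightarrow> real" and G :: "'a \<Rightarrow> 'a"
  assumes box: "\<And>i. i \<in> Basis \<Longrightarrow> a \<bullet> i < b \<bullet> i"
    and S: "finite S" "S \<subseteq> Basis"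
    and G: "continuous_on (cbox a b) G"
    and der: "\<And>x. x \<in> cbox a b \<Longrightarrow> (f has_derivative (\<lambda>h. h \<bullet> G x)) (at x within cbox a b)"
    and dep: "\<And>x j. x \<in> cbox a b \<Longrightarrow> j \<in> Basis - S \<Longrightarrow> G x \<bullet> j = 0"
  shows "poly_C1_approximable (cbox a b) f G"
  using S G der dep
proof (induction S arbitrary: f G rule: finite_induct)
  case empty
  have G0: "G x = 0" if "x \<in> cbox a b" for x
  proof (rule euclidean_eqI)
    fix j :: 'a assume "j \<in> Basis"
    then show "G x \<bullet> j = 0 \<bullet> j"
      using empty(4)[OF that, of j] by simp
  qed
  have "\<exists>c. \<forall>x\<in>cbox a b. f x = c"
  proof (rule has_derivative_zero_constant)
    show "(f has_derivative (\<lambda>h. 0)) (at x within cbox a b)" if "x \<in> cbox a b" for x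
      using empty(3)[OF that] by (simp add: G0[OF that])
  qed simp
  then obtain c where "\<forall>x\<in>cbox a b. f x = c" by blast
  then show ?case
    using G0 by (intro poly_C1_approximable_cong[OF poly_C1_approximable_const]) auto
next
  case (insert i S)
  have i: "i \<in> Basis" using insert by simp
  show ?case
  proof (rule poly_C1_approximable_Bernstein_step[OF box i])
    fix c :: real assume c: "c \<in> {0..1}"
    define r where "r x = x + (a \<bullet> i + c * (b \<bullet> i - a \<bullet> i) - x \<bullet> i) *\<^sub>R i" for x
    have r_box: "r x \<in> cbox a b" if "x \<in> cbox a b" for x
    proof -
      have "0 \<le> c * (b \<bullet> i - a \<bullet> i)" "c * (b \<bullet> i - a \<bullet> i) \<le> 1 * (b \<bullet> i - a \<bullet> i)"
        using c box[OF i] by (auto intro: mult_right_mono)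
      then show ?thesis
        using that i by (auto simp: r_def mem_box inner_add_left inner_Basis)
    qed
    have r_cont: "continuous_on (cbox a b) r"
      unfolding r_def by (intro continuous_intros)
    have "poly_C1_approximable (cbox a b) (\<lambda>x. f (r x)) (\<lambda>x. G (r x) - (G (r x) \<bullet> i) *\<^sub>R i)"
    proof (rule insert.IH)
      have "continuous_on (cbox a b) (\<lambda>x. G (r x))"
        using continuous_on_compose2[OF insert.prems(2) r_cont] r_box by blast
      then show "continuous_on (cbox a b) (\<lambda>x. G (r x) - (G (r x) \<bullet> i) *\<^sub>R i)"
        by (intro continuous_intros)
    next
      fix x assume x: "x \<in> cbox a b"
      have "(r has_derivative (\<lambda>h. h - (h \<bullet> i) *\<^sub>R i)) (at x within cbox a b)"
        unfolding r_def[abs_def] by (auto intro!: derivative_eq_intros)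
      moreover have "(f has_derivative (\<lambda>h. h \<bullet> G (r x))) (at (r x) within r ` cbox a b)"
        using insert.prems(3)[OF r_box[OF x]] r_box by (auto intro: has_derivative_subset)
      ultimately have "((\<lambda>x. f (r x)) has_derivative (\<lambda>h. (h - (h \<bullet> i) *\<^sub>R i) \<bullet> G (r x)))
          (at x within cbox a b)"
        by (rule has_derivative_in_compose)
      then show "((\<lambda>x. f (r x)) has_derivative (\<lambda>h. h \<bullet> (G (r x) - (G (r x) \<bullet> i) *\<^sub>R i)))
          (at x within cbox a b)"
        by (simp add: inner_diff_left inner_diff_right inner_commute mult.commute)
    next
      fix x j assume "x \<in> cbox a b" "j \<in> Basis - S"
      then show "(G (r x) - (G (r x) \<bullet> i) *\<^sub>R i) \<bullet> j = 0"
        using insert.prems(4)[OF r_box, of x j] i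
        by (cases "j = i") (auto simp: inner_diff_left inner_Basis)
    qed (use insert.prems in auto)
    then show "poly_C1_approximable (cbox a b)
         (\<lambda>x. f (x + (a \<bullet> i + c * (b \<bullet> i - a \<bullet> i) - x \<bullet> i) *\<^sub>R i))
         (\<lambda>x. G (x + (a \<bullet> i + c * (b \<bullet> i - a \<bullet> i) - x \<bullet> i) *\<^sub>R i)
              - (G (x + (a \<bullet> i + c * (b \<bullet> i - a \<bullet> i) - x \<bullet> i) *\<^sub>R i) \<bullet> i) *\<^sub>R i)"
      unfolding r_def .
  qed (use insert.prems in auto)
qed

theorem C1_imp_poly_C1_approximable:
  fixes f :: "'a::euclidean_space \<Rightarrow> real" and G :: "'a \<Rightarrow> 'a"
  assumes "\<And>i. i \<in> Basis \<Longrightarrow> a \<bullet> i < b \<bullet> i"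
    and "continuous_on (cbox a b) G"
    and "\<And>x. x \<in> cbox a b \<Longrightarrow> (f has_derivative (\<lambda>h. h \<bullet> G x)) (at x within cbox a b)"
  shows "poly_C1_approximable (cbox a b) f G"
  by (rule poly_C1_approximable_depending_on[OF assms(1) finite_Basis order_refl assms(2,3)]) simp_all

section \<open>The functions computed by a layer\<close>

text \<open>
  The possible arguments of \<open>\<sigma>\<close> at the neurons of layer \<open>h\<close> in networks with time weight \<open>\<alpha>\<close>, each
  neuron for itself. The finite set \<open>S\<close> stands for the neurons of the layer below, so that neurons
  of several networks are combined by taking unions.
\<close>

primrec layer_functions ::
    "(real \<Rightarrow> real) \<Rightarrow> real \<Rightarrow> nat \<Rightarrow> (real \<times> (real ^ 'n) \<Rightarrow> real) set" where
  "layer_functions \<sigma> \<alpha> 0 = {\<lambda>p. w \<bullet> snd p + \<alpha> * fst p + c | w c. True}"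
| "layer_functions \<sigma> \<alpha> (Suc h) =
     {\<lambda>p. (\<Sum>g\<in>S. a g * \<sigma> (g p)) + c | S a c. finite S \<and> S \<subseteq> layer_functions \<sigma> \<alpha> h}"

lemma preact_cong:
  assumes "in_weight \<theta> = in_weight \<theta>'" "time_weight \<theta> = time_weight \<theta>'"
    "\<And>i. i < h \<Longrightarrow> width \<theta> i = width \<theta>' i"
    "\<And>i. i \<le> h \<Longrightarrow> weight \<theta> i = weight \<theta>' i" "\<And>i. i \<le> h \<Longrightarrow> bias \<theta> i = bias \<theta>' i"
  shows "preact \<sigma> \<theta> t x h = preact \<sigma> \<theta>' t x h"
  using assms by (induction h) (simp_all add: fun_eq_iff)

text \<open>
  Finitely many functions of the same layer are realised simultaneously. The networks below them
  are merged by enumerating the union of the sets of neurons they use and giving weight zero to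
  superfluous connections. This requires that all of them share the time weight.
\<close>

lemma layer_functions_realised:
  assumes "\<And>j. j < m \<Longrightarrow> g j \<in> layer_functions \<sigma> \<alpha> h"
  shows "\<exists>\<theta> :: ('n::finite) network. hidden \<theta> = h \<and> time_weight \<theta> = \<alpha> \<and>
           (\<forall>j<m. \<forall>t x. preact \<sigma> \<theta> t x h j = g j (t, x))"
  using assms
proof (induction h arbitrary: g m)
  case 0
  then have "\<forall>j. \<exists>w c. j < m \<longrightarrow> g j = (\<lambda>p. w \<bullet> snd p + \<alpha> * fst p + c)"
    by fastforce
  then obtain w c where wc: "\<And>j. j < m \<Longrightarrow> g j = (\<lambda>p. w j \<bullet> snd p + \<alpha> * fst p + c j)"
    by metis
  show ?case
    by (rule exI[of _ "\<lparr>hidden = 0, width = \<lambda>_. 0, in_weight = w, time_weight = \<alpha>,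
          weight = \<lambda>_ _ _. 0, bias = \<lambda>_. c\<rparr>"]) (simp add: wc)
next
  case (Suc h)
  then have "\<forall>j. \<exists>S a c. j < m \<longrightarrow> finite S \<and> S \<subseteq> layer_functions \<sigma> \<alpha> h \<and>
      g j = (\<lambda>p. (\<Sum>k\<in>S. a k * \<sigma> (k p)) + c)"
    by fastforce
  then obtain S a c where SS: "\<forall>j. j < m \<longrightarrow> finite (S j) \<and> S j \<subseteq> layer_functions \<sigma> \<alpha> h \<and>
      g j = (\<lambda>p. (\<Sum>k\<in>S j. a j k * \<sigma> (k p)) + c j)"
    unfolding choice_iff by (elim exE) (rule that)
  then have S: "\<And>j. j < m \<Longrightarrow> finite (S j)"
      "\<And>j. j < m \<Longrightarrow> S j \<subseteq> layer_functions \<sigma> \<alpha> h"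
      "\<And>j. j < m \<Longrightarrow> g j = (\<lambda>p. (\<Sum>k\<in>S j. a j k * \<sigma> (k p)) + c j)"
    by blast+
  define U where "U = (\<Union>j<m. S j)"
  have U: "finite U" "U \<subseteq> layer_functions \<sigma> \<alpha> h"
    using S by (auto simp: U_def)
  obtain e where e: "bij_betw e {..<card U} U"
    using ex_bij_betw_nat_finite[OF U(1)] atLeast0LessThan by metis
  have "\<exists>\<theta> :: ('n::finite) network. hidden \<theta> = h \<and> time_weight \<theta> = \<alpha> \<and>
           (\<forall>j<card U. \<forall>t x. preact \<sigma> \<theta> t x h j = e j (t, x))"
    by (rule Suc.IH) (use bij_betw_apply[OF e] U(2) in blast)
  then obtain \<theta> :: "('n::finite) network" where \<theta>: "hidden \<theta> = h" "time_weight \<theta> = \<alpha>"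
      "\<And>j t x. j < card U \<Longrightarrow> preact \<sigma> \<theta> t x h j = e j (t, x)"
    by blast
  define b where "b j k = (if k \<in> S j then a j k else 0)" for j k
  define \<theta>' where "\<theta>' = \<theta>\<lparr>hidden := Suc h, width := (width \<theta>)(h := card U),
      weight := (weight \<theta>)(Suc h := (\<lambda>j k. b j (e k))), bias := (bias \<theta>)(Suc h := c)\<rparr>"
  have same: "preact \<sigma> \<theta>' t x h = preact \<sigma> \<theta> t x h" for t x
    by (rule preact_cong) (auto simp: \<theta>'_def)
  have "preact \<sigma> \<theta>' t x (Suc h) j = g j (t, x)" if j: "j < m" for j t x
  proof -
    have "preact \<sigma> \<theta>' t x (Suc h) j = (\<Sum>k<card U. b j (e k) * \<sigma> (preact \<sigma> \<theta>' t x h k)) + c j"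
      by (simp add: \<theta>'_def)
    also have "(\<Sum>k<card U. b j (e k) * \<sigma> (preact \<sigma> \<theta>' t x h k))
        = (\<Sum>k<card U. b j (e k) * \<sigma> (e k (t, x)))"
      by (rule sum.cong) (auto simp: same \<theta>(3))
    also have "\<dots> = (\<Sum>k\<in>U. b j k * \<sigma> (k (t, x)))"
      by (rule sum.reindex_bij_betw[OF e])
    also have "\<dots> = (\<Sum>k\<in>S j. a j k * \<sigma> (k (t, x)))"
      by (rule sum.mono_neutral_cong_right) (use U(1) j in \<open>auto simp: U_def b_def\<close>)
    finally show ?thesis using S(3)[OF j] by simp
  qed
  moreover have "hidden \<theta>' = Suc h" "time_weight \<theta>' = \<alpha>"
    by (simp_all add: \<theta>'_def \<theta>(2))
  ultimately show ?case by blast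
qed

lemma layer_function_is_network:
  assumes "g \<in> layer_functions \<sigma> \<alpha> h"
  obtains \<theta> :: "('n::finite) network" where "\<And>t x. network_fun \<sigma> \<theta> t x = g (t, x)"
proof -
  obtain \<theta> :: "('n::finite) network" where "hidden \<theta> = h" "\<forall>j<1. \<forall>t x. preact \<sigma> \<theta> t x h j = g (t, x)"
    using layer_functions_realised[of 1 "\<lambda>_. g" \<sigma> \<alpha> h] assms by blast
  then have "network_fun \<sigma> \<theta> t x = g (t, x)" for t x
    unfolding network_fun_def by simp
  then show ?thesis by (rule that)
qed

lemma layer_functions_neuron:
  assumes "g \<in> layer_functions \<sigma> \<alpha> h"
  shows "(\<lambda>p. u * \<sigma> (g p) + c) \<in> layer_functions \<sigma> \<alpha> (Suc h)"
proof -
  have "(\<lambda>p. u * \<sigma> (g p) + c) = (\<lambda>p. (\<Sum>k\<in>{g}. u * \<sigma> (k p)) + c)" by simp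
  then show ?thesis
    using assms unfolding layer_functions.simps mem_Collect_eq
    by (intro exI[of _ "{g}"] exI[of _ "\<lambda>_. u"] exI[of _ c]) simp
qed

lemma layer_functions_affine:
  assumes "g \<in> layer_functions \<sigma> \<alpha> (Suc h)" "g' \<in> layer_functions \<sigma> \<alpha> (Suc h)"
  shows "(\<lambda>p. u * g p + u' * g' p + c) \<in> layer_functions \<sigma> \<alpha> (Suc h)"
proof -
  obtain S a d where S: "finite S" "S \<subseteq> layer_functions \<sigma> \<alpha> h" "g = (\<lambda>p. (\<Sum>k\<in>S. a k * \<sigma> (k p)) + d)"
    using assms(1) by auto
  obtain S' a' d' where S': "finite S'" "S' \<subseteq> layer_functions \<sigma> \<alpha> h"
      "g' = (\<lambda>p. (\<Sum>k\<in>S'. a' k * \<sigma> (k p)) + d')"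
    using assms(2) by auto
  define b where "b k = u * (if k \<in> S then a k else 0) + u' * (if k \<in> S' then a' k else 0)" for k
  have "u * g p + u' * g' p + c = (\<Sum>k\<in>S \<union> S'. b k * \<sigma> (k p)) + (u * d + u' * d' + c)" for p
  proof -
    have 1: "(\<Sum>k\<in>S. a k * \<sigma> (k p)) = (\<Sum>k\<in>S \<union> S'. (if k \<in> S then a k else 0) * \<sigma> (k p))"
      by (rule sum.mono_neutral_cong_left) (use S(1) S'(1) in auto)
    have 2: "(\<Sum>k\<in>S'. a' k * \<sigma> (k p)) = (\<Sum>k\<in>S \<union> S'. (if k \<in> S' then a' k else 0) * \<sigma> (k p))"
      by (rule sum.mono_neutral_cong_left) (use S(1) S'(1) in auto)
    have "(\<Sum>k\<in>S \<union> S'. b k * \<sigma> (k p))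
        = u * (\<Sum>k\<in>S. a k * \<sigma> (k p)) + u' * (\<Sum>k\<in>S'. a' k * \<sigma> (k p))"
      unfolding 1 2 sum_distrib_left sum.distrib[symmetric] b_def
      by (rule sum.cong) (simp_all add: algebra_simps)
    then show ?thesis
      unfolding S(3) S'(3) by (simp add: distrib_left)
  qed
  then have "(\<lambda>p. u * g p + u' * g' p + c) = (\<lambda>p. (\<Sum>k\<in>S \<union> S'. b k * \<sigma> (k p)) + (u * d + u' * d' + c))"
    by (rule ext)
  then show ?thesis
    using S(1,2) S'(1,2) unfolding layer_functions.simps mem_Collect_eq
    by (intro exI[of _ "S \<union> S'"] exI[of _ b] exI[of _ "u * d + u' * d' + c"]) simp
qed

section \<open>Difference quotients of the activation\<close>

text \<open>
  Both the outer and the inner function vary. As \<open>f\<close> is bounded, the inner values eventually stay in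
  one compact interval, on which \<open>q\<close> converges uniformly and \<open>q0\<close> is uniformly continuous.
\<close>

lemma uniform_limit_compose_families:
  fixes q :: "real \<Rightarrow> real \<Rightarrow> real" and g :: "real \<Rightarrow> 'a \<Rightarrow> real"
  assumes q: "\<And>M. uniform_limit {-M..M} q q0 F" and cont: "continuous_on UNIV q0"
    and g: "uniform_limit B g f F" and bdd: "bounded (f ` B)"
  shows "uniform_limit B (\<lambda>n p. q n (g n p)) (\<lambda>p. q0 (f p)) F"
proof -
  obtain M where M: "\<And>p. p \<in> B \<Longrightarrow> \<bar>f p\<bar> \<le> M"
    using bdd unfolding bounded_iff by auto
  let ?I = "{- (M + 1)..M + 1}"
  have "\<forall>\<^sub>F n in F. \<forall>p\<in>B. dist (g n p) (f p) < 1"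
    using g unfolding uniform_limit_iff by simp
  then have in_I: "\<forall>\<^sub>F n in F. \<forall>p\<in>B. g n p \<in> ?I"
  proof eventually_elim
    case (elim n)
    show ?case
    proof
      fix p assume "p \<in> B"
      then have "\<bar>g n p - f p\<bar> < 1" "\<bar>f p\<bar> \<le> M"
        using elim M by (auto simp: dist_real_def)
      then show "g n p \<in> ?I" by auto
    qed
  qed
  have "uniformly_continuous_on ?I q0"
    by (intro compact_uniformly_continuous continuous_on_subset[OF cont]) auto
  then have lim: "uniform_limit B (\<lambda>n p. q0 (g n p)) (\<lambda>p. q0 (f p)) F"
    using in_I by (intro uniform_limit_compose_uniformly_continuous_on[OF g]) auto
  show ?thesis
  proof (rule uniform_limitI)
    fix e :: real assume "e > 0"
    then have e2: "e / 2 > 0" by simp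
    show "\<forall>\<^sub>F n in F. \<forall>p\<in>B. dist (q n (g n p)) (q0 (f p)) < e"
      using uniform_limitD[OF q[of "M + 1"] e2] uniform_limitD[OF lim e2] in_I
    proof eventually_elim
      case (elim n)
      show ?case
      proof
        fix p assume p: "p \<in> B"
        have "dist (q n (g n p)) (q0 (g n p)) < e / 2" "dist (q0 (g n p)) (q0 (f p)) < e / 2"
          using elim p by blast+
        then show "dist (q n (g n p)) (q0 (f p)) < e"
          using dist_triangle_less_add[of "q n (g n p)" "q0 (g n p)" "e / 2" "q0 (f p)" "e / 2"]
          by (simp add: dist_commute)
      qed
    qed
  qed
qed

text \<open>
  The mean value inequality for \<open>q n - q0\<close> on \<open>[-M, M]\<close>, starting from the common value at the origin.
\<close>

lemma uniform_limit_from_derivative: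
  fixes q q' :: "real \<Rightarrow> real \<Rightarrow> real"
  assumes der: "\<forall>\<^sub>F n in F. \<forall>y. (q n has_real_derivative q' n y) (at y)"
    and der0: "\<And>y. (q0 has_real_derivative q0' y) (at y)"
    and origin: "\<forall>\<^sub>F n in F. q n 0 = q0 0"
    and lim: "uniform_limit {-M..M} q' q0' F"
  shows "uniform_limit {-M..M} q q0 F"
proof (cases "M > 0")
  case True
  show ?thesis
  proof (rule uniform_limitI)
    fix e :: real assume "e > 0"
    then have d: "e / (2 * M) > 0" using True by simp
    show "\<forall>\<^sub>F n in F. \<forall>y\<in>{-M..M}. dist (q n y) (q0 y) < e"
      using der origin uniform_limitD[OF lim d]
    proof eventually_elim
      case (elim n)
      show ?case
      proof
        fix y assume y: "y \<in> {-M..M}"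
        have "norm ((q n y - q0 y) - (q n 0 - q0 0)) \<le> e / (2 * M) * norm (y - 0)"
        proof (rule field_differentiable_bound[of "{-M..M}"])
          show "((\<lambda>y. q n y - q0 y) has_real_derivative q' n z - q0' z) (at z within {-M..M})" for z
            by (rule has_field_derivative_at_within, rule DERIV_diff) (use elim(1) der0 in auto)
          show "norm (q' n z - q0' z) \<le> e / (2 * M)" if "z \<in> {-M..M}" for z
            using elim(3) that by (simp add: dist_real_def less_imp_le)
        qed (use y True in auto)
        also have "\<dots> \<le> e / (2 * M) * M"
          using y d by (intro mult_left_mono) auto
        also have "\<dots> < e"
          using True \<open>e > 0\<close> by simp
        finally show "dist (q n y) (q0 y) < e"
          using elim(2) by (simp add: dist_real_def)
      qed
    qed
  qed
next
  case False
  have "\<forall>\<^sub>F n in F. \<forall>y\<in>{-M..M}. q n y = q0 y"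
    using origin
  proof eventually_elim
    case (elim n)
    have "y = 0" if "y \<in> {-M..M}" for y using that False by auto
    with elim show ?case by metis
  qed
  then show ?thesis
    unfolding uniform_limit_iff by (auto elim: eventually_mono)
qed

text \<open>
  \<open>C\<^sup>1\<close> convergence, uniform on bounded intervals, of functions of one real variable for \<open>\<alpha> \<rightarrow> 0+\<close>.
\<close>

definition C1_family_limit ::
    "(real \<Rightarrow> real \<Rightarrow> real) \<Rightarrow> (real \<Rightarrow> real \<Rightarrow> real) \<Rightarrow> (real \<Rightarrow> real) \<Rightarrow> (real \<Rightarrow> real) \<Rightarrow> bool" where
  "C1_family_limit q q' q0 q0' \<longleftrightarrow>
     (\<forall>\<alpha>>0. \<forall>y. (q \<alpha> has_real_derivative q' \<alpha> y) (at y)) \<and>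
     (\<forall>y. (q0 has_real_derivative q0' y) (at y)) \<and> continuous_on UNIV q0' \<and>
     (\<forall>M. uniform_limit {-M..M} q q0 (at_right 0)) \<and>
     (\<forall>M. uniform_limit {-M..M} q' q0' (at_right 0))"

lemma C1_family_limit_difference_quotient:
  assumes \<sigma>: "\<And>x. (\<sigma> has_real_derivative s1 x) (at x)" and s1: "isCont s1 c" "s1 c \<noteq> 0"
  shows "C1_family_limit (\<lambda>\<alpha> y. (\<sigma> (c + \<alpha> * y) - \<sigma> c) / (\<alpha> * s1 c))
           (\<lambda>\<alpha> y. s1 (c + \<alpha> * y) / s1 c) (\<lambda>y. y) (\<lambda>y. 1)"
    (is "C1_family_limit ?q ?q' _ _")
proof -
  have der: "(?q \<alpha> has_real_derivative ?q' \<alpha> y) (at y)" if "\<alpha> > 0" for \<alpha> y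
  proof -
    have "((\<lambda>y. \<sigma> (c + \<alpha> * y)) has_real_derivative s1 (c + \<alpha> * y) * \<alpha>) (at y)"
      by (rule DERIV_chain2[OF \<sigma>]) (auto intro!: derivative_eq_intros)
    then have "(?q \<alpha> has_real_derivative (s1 (c + \<alpha> * y) * \<alpha> - 0) / (\<alpha> * s1 c)) (at y)"
      by (intro DERIV_cdivide DERIV_diff DERIV_const)
    then show ?thesis using that by simp
  qed
  have lim: "uniform_limit {-M..M} ?q' (\<lambda>y. 1) (at_right 0)" for M
  proof (rule uniform_limitI)
    fix e :: real assume e: "e > 0"
    then have "e * \<bar>s1 c\<bar> > 0" using s1 by simp
    then obtain d where d: "d > 0" "\<And>z. \<bar>z - c\<bar> < d \<Longrightarrow> \<bar>s1 z - s1 c\<bar> < e * \<bar>s1 c\<bar>"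
      using s1(1) unfolding continuous_at_eps_delta dist_real_def by metis
    define M' where "M' = max M 1"
    have M': "M' > 0" "M \<le> M'" by (auto simp: M'_def)
    show "\<forall>\<^sub>F \<alpha> in at_right 0. \<forall>y\<in>{-M..M}. dist (?q' \<alpha> y) 1 < e"
    proof (rule eventually_at_rightI[of 0 "d / M'"])
      fix \<alpha> assume \<alpha>: "\<alpha> \<in> {0<..<d / M'}"
      show "\<forall>y\<in>{-M..M}. dist (?q' \<alpha> y) 1 < e"
      proof
        fix y assume "y \<in> {-M..M}"
        then have "\<bar>\<alpha> * y\<bar> \<le> \<alpha> * M'"
          using \<alpha> M' by (auto simp: abs_mult intro!: mult_left_mono)
        also have "\<dots> < d" using \<alpha> M' by (simp add: pos_less_divide_eq)
        finally have "\<bar>s1 (c + \<alpha> * y) - s1 c\<bar> < e * \<bar>s1 c\<bar>"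
          by (intro d(2)) simp
        then have "\<bar>s1 (c + \<alpha> * y) - s1 c\<bar> / \<bar>s1 c\<bar> < e"
          using s1(2) by (simp add: divide_less_eq)
        moreover have "?q' \<alpha> y - 1 = (s1 (c + \<alpha> * y) - s1 c) / s1 c"
          using s1(2) by (simp add: diff_divide_distrib)
        ultimately show "dist (?q' \<alpha> y) 1 < e"
          unfolding dist_real_def by (simp add: abs_divide)
      qed
    qed (use d M' in auto)
  qed
  have "uniform_limit {-M..M} ?q (\<lambda>y. y) (at_right 0)" for M
  proof (rule uniform_limit_from_derivative[OF _ _ _ lim])
    show "\<forall>\<^sub>F \<alpha> in at_right 0. \<forall>y. (?q \<alpha> has_real_derivative ?q' \<alpha> y) (at y)"
      by (rule eventually_at_rightI[of 0 1]) (auto intro!: der)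
  qed auto
  with der lim show ?thesis
    unfolding C1_family_limit_def by simp
qed

text \<open>
  The derivative of the second difference quotient is a symmetric first difference quotient of
  \<open>\<sigma>'\<close>, so differentiability of \<open>\<sigma>'\<close> at the single point \<open>c\<close> suffices for convergence in \<open>C\<^sup>1\<close>.
\<close>

lemma C1_family_limit_second_difference_quotient:
  assumes \<sigma>: "\<And>x. (\<sigma> has_real_derivative s1 x) (at x)"
    and s1: "(s1 has_real_derivative s2) (at c)" and s2: "s2 \<noteq> 0"
  shows "C1_family_limit (\<lambda>\<alpha> y. (\<sigma> (c + \<alpha> * y) - 2 * \<sigma> c + \<sigma> (c - \<alpha> * y)) / (\<alpha>\<^sup>2 * s2))
           (\<lambda>\<alpha> y. (s1 (c + \<alpha> * y) - s1 (c - \<alpha> * y)) / (\<alpha> * s2)) (\<lambda>y. y\<^sup>2) (\<lambda>y. 2 * y)"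
    (is "C1_family_limit ?q ?q' _ _")
proof -
  have der: "(?q \<alpha> has_real_derivative ?q' \<alpha> y) (at y)" if "\<alpha> > 0" for \<alpha> y
  proof -
    have p: "((\<lambda>y. \<sigma> (c + \<alpha> * y)) has_real_derivative s1 (c + \<alpha> * y) * \<alpha>) (at y)"
      by (rule DERIV_chain2[OF \<sigma>]) (auto intro!: derivative_eq_intros)
    have m: "((\<lambda>y. \<sigma> (c - \<alpha> * y)) has_real_derivative s1 (c - \<alpha> * y) * (- \<alpha>)) (at y)"
      by (rule DERIV_chain2[OF \<sigma>]) (auto intro!: derivative_eq_intros)
    have "(?q \<alpha> has_real_derivative
        (s1 (c + \<alpha> * y) * \<alpha> - 0 + s1 (c - \<alpha> * y) * (- \<alpha>)) / (\<alpha>\<^sup>2 * s2)) (at y)"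
      by (intro DERIV_cdivide DERIV_add DERIV_diff DERIV_const p m)
    moreover have "(s1 (c + \<alpha> * y) * \<alpha> - 0 + s1 (c - \<alpha> * y) * (- \<alpha>)) / (\<alpha>\<^sup>2 * s2) = ?q' \<alpha> y"
      using that s2 by (simp add: field_simps power2_eq_square)
    ultimately show ?thesis by simp
  qed
  have lim: "uniform_limit {-M..M} ?q' (\<lambda>y. 2 * y) (at_right 0)" for M
  proof (rule uniform_limitI)
    fix e :: real assume e: "e > 0"
    define M' where "M' = max M 1"
    have M': "M' > 0" "M \<le> M'" by (auto simp: M'_def)
    \<comment> \<open>The two remainders of the first order expansions of \<open>\<sigma>'\<close> add up to \<open>2/3 e\<close> after division.\<close>
    define \<eta> where "\<eta> = e * \<bar>s2\<bar> / (3 * M')"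
    have \<eta>: "\<eta> > 0" using e s2 M' by (simp add: \<eta>_def)
    have "(s1 has_derivative (\<lambda>h. s2 * h)) (at c)"
      using s1 by (simp add: has_field_derivative_def)
    then obtain d where d: "d > 0"
        "\<And>z. \<bar>z - c\<bar> < d \<Longrightarrow> \<bar>s1 z - s1 c - s2 * (z - c)\<bar> \<le> \<eta> * \<bar>z - c\<bar>"
      using \<eta> unfolding has_derivative_at_alt real_norm_def by blast
    show "\<forall>\<^sub>F \<alpha> in at_right 0. \<forall>y\<in>{-M..M}. dist (?q' \<alpha> y) (2 * y) < e"
    proof (rule eventually_at_rightI[of 0 "d / M'"])
      fix \<alpha> assume \<alpha>: "\<alpha> \<in> {0<..<d / M'}"
      show "\<forall>y\<in>{-M..M}. dist (?q' \<alpha> y) (2 * y) < e"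
      proof
        fix y assume "y \<in> {-M..M}"
        then have y: "\<bar>\<alpha> * y\<bar> \<le> \<alpha> * M'"
          using \<alpha> M' by (auto simp: abs_mult intro!: mult_left_mono)
        also have "\<dots> < d" using \<alpha> M' by (simp add: pos_less_divide_eq)
        finally have small: "\<bar>\<alpha> * y\<bar> < d" .
        have p: "\<bar>s1 (c + \<alpha> * y) - s1 c - s2 * (\<alpha> * y)\<bar> \<le> \<eta> * \<bar>\<alpha> * y\<bar>"
          using d(2)[of "c + \<alpha> * y"] small by simp
        have m: "\<bar>s1 (c - \<alpha> * y) - s1 c + s2 * (\<alpha> * y)\<bar> \<le> \<eta> * \<bar>\<alpha> * y\<bar>"
          using d(2)[of "c - \<alpha> * y"] small by simp
        have "\<bar>s1 (c + \<alpha> * y) - s1 (c - \<alpha> * y) - 2 * (s2 * (\<alpha> * y))\<bar> \<le> 2 * (\<eta> * \<bar>\<alpha> * y\<bar>)"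
          using p m by linarith
        also have "\<dots> \<le> 2 * (\<eta> * (\<alpha> * M'))"
          using y \<eta> by (intro mult_left_mono) auto
        also have "\<dots> = 2 / 3 * e * (\<alpha> * \<bar>s2\<bar>)"
          using M' by (simp add: \<eta>_def)
        also have "\<dots> < e * (\<alpha> * \<bar>s2\<bar>)"
          using e \<alpha> s2 by (intro mult_strict_right_mono) auto
        finally have "\<bar>s1 (c + \<alpha> * y) - s1 (c - \<alpha> * y) - 2 * (s2 * (\<alpha> * y))\<bar> / (\<alpha> * \<bar>s2\<bar>) < e"
          using \<alpha> s2 by (simp add: divide_less_eq)
        moreover have "?q' \<alpha> y - 2 * y
            = (s1 (c + \<alpha> * y) - s1 (c - \<alpha> * y) - 2 * (s2 * (\<alpha> * y))) / (\<alpha> * s2)"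
          using \<alpha> s2 by (simp add: diff_divide_distrib)
        ultimately show "dist (?q' \<alpha> y) (2 * y) < e"
          using \<alpha> unfolding dist_real_def by (simp add: abs_divide abs_mult)
      qed
    qed (use d M' in auto)
  qed
  have "uniform_limit {-M..M} ?q (\<lambda>y. y\<^sup>2) (at_right 0)" for M
  proof (rule uniform_limit_from_derivative[OF _ _ _ lim])
    show "\<forall>\<^sub>F \<alpha> in at_right 0. \<forall>y. (?q \<alpha> has_real_derivative ?q' \<alpha> y) (at y)"
      by (rule eventually_at_rightI[of 0 1]) (auto intro!: der)
  qed (auto intro!: derivative_eq_intros)
  moreover have "((\<lambda>y. y\<^sup>2) has_real_derivative 2 * y) (at y)" for y :: real
    by (auto intro!: derivative_eq_intros)
  moreover have "continuous_on UNIV (\<lambda>y :: real. 2 * y)"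
    by (intro continuous_intros)
  ultimately show ?thesis
    using der lim unfolding C1_family_limit_def by simp
qed

section \<open>Networks approximate polynomials in \<open>C\<^sup>1\<close>\<close>

lemma GDERIV_continuous_on: "(\<And>p. GDERIV f p :> f' p) \<Longrightarrow> continuous_on S f"
  unfolding gderiv_def
  by (meson has_derivative_continuous continuous_at_imp_continuous_on)

text \<open>
  \<open>f\<close> is the limit in \<open>C\<^sup>1\<close> on \<open>B\<close> of networks with \<open>Suc h\<close> hidden layers, the \<open>\<alpha>\<close>-th of which has time
  weight \<open>\<alpha>\<close>. Indexing by the time weight keeps families of different functions compatible, so
  that they can be combined in one network.
\<close>

definition network_C1_limit ::
    "(real \<Rightarrow> real) \<Rightarrow> (real \<times> (real ^ 'n)) set \<Rightarrow> nat
      \<Rightarrow> (real \<times> (real ^ 'n) \<Rightarrow> real) \<Rightarrow> (real \<times> (real ^ 'n) \<Rightarrow> real \<times> (real ^ 'n)) \<Rightarrow> bool" where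
  "network_C1_limit \<sigma> B h f f' \<longleftrightarrow>
     (\<forall>p. GDERIV f p :> f' p) \<and> continuous_on UNIV f' \<and>
     (\<exists>g g'. (\<forall>\<alpha>>0. g \<alpha> \<in> layer_functions \<sigma> \<alpha> (Suc h) \<and> (\<forall>p. GDERIV (g \<alpha>) p :> g' \<alpha> p)) \<and>
        uniform_limit B g f (at_right 0) \<and> uniform_limit B g' f' (at_right 0))"

text \<open>
  The common core of the three constructions that follow, in which \<open>q\<close> is a difference quotient of
  \<open>\<sigma>\<close> with step \<open>\<alpha>\<close> and \<open>g\<close> comes from the layer below.
\<close>

lemma network_C1_limit_compose:
  fixes f :: "real \<times> (real ^ 'n) \<Rightarrow> real"
  assumes q: "C1_family_limit q q' q0 q0'" and B: "compact B"
    and f: "\<And>p. GDERIV f p :> f' p" "continuous_on UNIV f'"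
    and g: "\<And>\<alpha> p. \<alpha> > 0 \<Longrightarrow> GDERIV (g \<alpha>) p :> g' \<alpha> p"
      "uniform_limit B g f (at_right 0)" "uniform_limit B g' f' (at_right 0)"
    and layer: "\<And>\<alpha>. \<alpha> > 0 \<Longrightarrow> (\<lambda>p. q \<alpha> (g \<alpha> p)) \<in> layer_functions \<sigma> \<alpha> (Suc h)"
  shows "network_C1_limit \<sigma> B h (\<lambda>p. q0 (f p)) (\<lambda>p. q0' (f p) *\<^sub>R f' p)"
proof -
  have qd: "\<And>\<alpha> y. \<alpha> > 0 \<Longrightarrow> (q \<alpha> has_real_derivative q' \<alpha> y) (at y)"
    and q0d: "\<And>y. (q0 has_real_derivative q0' y) (at y)"
    and q0c: "continuous_on UNIV q0'"
    and qlim: "\<And>M. uniform_limit {-M..M} q q0 (at_right 0)"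
      "\<And>M. uniform_limit {-M..M} q' q0' (at_right 0)"
    using q unfolding C1_family_limit_def by blast+
  have fc: "continuous_on S f" for S
    by (rule GDERIV_continuous_on[OF f(1)])
  have fb: "bounded (f ` B)"
    by (rule compact_imp_bounded[OF compact_continuous_image[OF fc B]])
  have f'b: "bounded (f' ` B)"
    by (rule compact_imp_bounded[OF compact_continuous_image[OF continuous_on_subset[OF f(2)] B]]) simp
  have "continuous_on UNIV q0"
    by (rule DERIV_continuous_on[OF q0d])
  then have lim: "uniform_limit B (\<lambda>\<alpha> p. q \<alpha> (g \<alpha> p)) (\<lambda>p. q0 (f p)) (at_right 0)"
    by (rule uniform_limit_compose_families[OF qlim(1) _ g(2) fb])
  have q0f: "continuous_on S (\<lambda>p. q0' (f p))" for S
    by (rule continuous_on_compose2[OF q0c fc]) simp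
  have q0fb: "bounded ((\<lambda>p. q0' (f p)) ` B)"
    by (rule compact_imp_bounded[OF compact_continuous_image[OF q0f B]])
  have lim': "uniform_limit B (\<lambda>\<alpha> p. q' \<alpha> (g \<alpha> p) *\<^sub>R g' \<alpha> p) (\<lambda>p. q0' (f p) *\<^sub>R f' p) (at_right 0)"
    by (rule bounded_bilinear.bounded_uniform_limit[OF bounded_bilinear_scaleR
          uniform_limit_compose_families[OF qlim(2) q0c g(2) fb] g(3) f'b q0fb])
  show ?thesis
    unfolding network_C1_limit_def
  proof (intro conjI allI)
    show "GDERIV (\<lambda>p. q0 (f p)) p :> q0' (f p) *\<^sub>R f' p" for p
      by (rule GDERIV_DERIV_compose[OF f(1) q0d])
    show "continuous_on UNIV (\<lambda>p. q0' (f p) *\<^sub>R f' p)"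
      by (rule continuous_on_scaleR[OF q0f f(2)])
    show "\<exists>G G'. (\<forall>\<alpha>>0. G \<alpha> \<in> layer_functions \<sigma> \<alpha> (Suc h) \<and> (\<forall>p. GDERIV (G \<alpha>) p :> G' \<alpha> p)) \<and>
        uniform_limit B G (\<lambda>p. q0 (f p)) (at_right 0) \<and>
        uniform_limit B G' (\<lambda>p. q0' (f p) *\<^sub>R f' p) (at_right 0)"
    proof (rule exI[of _ "\<lambda>\<alpha> p. q \<alpha> (g \<alpha> p)"], rule exI[of _ "\<lambda>\<alpha> p. q' \<alpha> (g \<alpha> p) *\<^sub>R g' \<alpha> p"],
        intro conjI allI impI lim lim' layer)
      fix \<alpha> :: real and p assume "\<alpha> > 0"
      show "GDERIV (\<lambda>p. q \<alpha> (g \<alpha> p)) p :> q' \<alpha> (g \<alpha> p) *\<^sub>R g' \<alpha> p"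
        by (rule GDERIV_DERIV_compose[OF g(1)[OF \<open>\<alpha> > 0\<close>] qd[OF \<open>\<alpha> > 0\<close>]])
    qed
  qed
qed

lemma network_C1_limit_affine:
  assumes "network_C1_limit \<sigma> B h f1 f1'" "network_C1_limit \<sigma> B h f2 f2'"
  shows "network_C1_limit \<sigma> B h (\<lambda>p. u * f1 p + v * f2 p + c) (\<lambda>p. u *\<^sub>R f1' p + v *\<^sub>R f2' p)"
proof -
  obtain g1 g1' where 1: "\<And>p. GDERIV f1 p :> f1' p" "continuous_on UNIV f1'"
      "\<And>\<alpha>. \<alpha> > 0 \<Longrightarrow> g1 \<alpha> \<in> layer_functions \<sigma> \<alpha> (Suc h)"
      "\<And>\<alpha> p. \<alpha> > 0 \<Longrightarrow> GDERIV (g1 \<alpha>) p :> g1' \<alpha> p"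
      "uniform_limit B g1 f1 (at_right 0)" "uniform_limit B g1' f1' (at_right 0)"
    using assms(1) unfolding network_C1_limit_def by blast
  obtain g2 g2' where 2: "\<And>p. GDERIV f2 p :> f2' p" "continuous_on UNIV f2'"
      "\<And>\<alpha>. \<alpha> > 0 \<Longrightarrow> g2 \<alpha> \<in> layer_functions \<sigma> \<alpha> (Suc h)"
      "\<And>\<alpha> p. \<alpha> > 0 \<Longrightarrow> GDERIV (g2 \<alpha>) p :> g2' \<alpha> p"
      "uniform_limit B g2 f2 (at_right 0)" "uniform_limit B g2' f2' (at_right 0)"
    using assms(2) unfolding network_C1_limit_def by blast
  have grad: "GDERIV (\<lambda>p. u * k1 p + v * k2 p + c) p :> u *\<^sub>R d1 + v *\<^sub>R d2"
    if "GDERIV k1 p :> d1" "GDERIV k2 p :> d2" for k1 k2 :: "real \<times> (real ^ 'a) \<Rightarrow> real" and p d1 d2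
    using that unfolding gderiv_def by (auto intro!: derivative_eq_intros simp: inner_add_right)
  show ?thesis
    unfolding network_C1_limit_def
  proof (intro conjI allI)
    show "continuous_on UNIV (\<lambda>p. u *\<^sub>R f1' p + v *\<^sub>R f2' p)"
      by (intro continuous_intros 1 2)
    show "\<exists>G G'. (\<forall>\<alpha>>0. G \<alpha> \<in> layer_functions \<sigma> \<alpha> (Suc h) \<and> (\<forall>p. GDERIV (G \<alpha>) p :> G' \<alpha> p)) \<and>
        uniform_limit B G (\<lambda>p. u * f1 p + v * f2 p + c) (at_right 0) \<and>
        uniform_limit B G' (\<lambda>p. u *\<^sub>R f1' p + v *\<^sub>R f2' p) (at_right 0)"
    proof (rule exI[of _ "\<lambda>\<alpha> p. u * g1 \<alpha> p + v * g2 \<alpha> p + c"],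
        rule exI[of _ "\<lambda>\<alpha> p. u *\<^sub>R g1' \<alpha> p + v *\<^sub>R g2' \<alpha> p"], intro conjI allI impI)
      show "uniform_limit B (\<lambda>\<alpha> p. u * g1 \<alpha> p + v * g2 \<alpha> p + c) (\<lambda>p. u * f1 p + v * f2 p + c) (at_right 0)"
        using 1(5) 2(5) by (intro uniform_limit_intros)
      show "uniform_limit B (\<lambda>\<alpha> p. u *\<^sub>R g1' \<alpha> p + v *\<^sub>R g2' \<alpha> p) (\<lambda>p. u *\<^sub>R f1' p + v *\<^sub>R f2' p) (at_right 0)"
        using 1(6) 2(6) by (intro uniform_limit_intros)
    qed (intro layer_functions_affine grad 1 2; assumption)+
  qed (intro grad 1 2)
qed

text \<open>
  \<open>c1\<close> and \<open>c2\<close> are the base points of the first and second difference quotients of \<open>\<sigma>\<close>, which are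
  normalised by \<open>\<sigma>'(c1)\<close> and \<open>\<sigma>''(c2)\<close>. The two points are unrelated.
\<close>

locale smooth_nonaffine =
  fixes \<sigma> s1 :: "real \<Rightarrow> real" and c1 c2 s2 :: real
  assumes DERIV_\<sigma>: "(\<sigma> has_real_derivative s1 x) (at x)"
    and s1_cont: "isCont s1 c1" and s1_nonzero: "s1 c1 \<noteq> 0"
    and DERIV_s1: "(s1 has_real_derivative s2) (at c2)" and s2_nonzero: "s2 \<noteq> 0"
begin

text \<open>
  Step \<open>\<alpha>\<close> and time weight \<open>\<alpha>\<close> cancel: the weights \<open>\<alpha> w\<close> and \<open>\<alpha>\<close> give the argument
  \<open>c1 + \<alpha> (\<langle>w, x\<rangle> + t)\<close> of the difference quotient of \<open>\<sigma>\<close> at \<open>c1\<close>.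
\<close>

lemma network_C1_limit_ridge:
  fixes B :: "(real \<times> (real ^ 'n)) set"
  assumes "compact B"
  shows "network_C1_limit \<sigma> B 0 (\<lambda>p. w \<bullet> snd p + fst p) (\<lambda>p. (1, w))"
proof -
  have "network_C1_limit \<sigma> B 0 (\<lambda>p. w \<bullet> snd p + fst p) (\<lambda>p. 1 *\<^sub>R (1, w))"
  proof (rule network_C1_limit_compose[OF C1_family_limit_difference_quotient[OF DERIV_\<sigma> s1_cont s1_nonzero]
        assms, where g = "\<lambda>\<alpha> p. w \<bullet> snd p + fst p" and g' = "\<lambda>\<alpha> p. (1, w)"])
    show "GDERIV (\<lambda>p. w \<bullet> snd p + fst p) p :> (1, w)" for p :: "real \<times> (real ^ 'n)"
      unfolding gderiv_def
      by (auto intro!: derivative_eq_intros simp: inner_prod_def inner_commute)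
    then show "GDERIV (\<lambda>p. w \<bullet> snd p + fst p) p :> (1, w)" for p :: "real \<times> (real ^ 'n)" .
    show "(\<lambda>p. (\<sigma> (c1 + \<alpha> * (w \<bullet> snd p + fst p)) - \<sigma> c1) / (\<alpha> * s1 c1))
        \<in> layer_functions \<sigma> \<alpha> (Suc 0)" if "\<alpha> > 0" for \<alpha> :: real
    proof -
      have "(\<lambda>p. (\<alpha> *\<^sub>R w) \<bullet> snd p + \<alpha> * fst p + c1) \<in> layer_functions \<sigma> \<alpha> 0"
        unfolding layer_functions.simps by blast
      from layer_functions_neuron[OF this, of "1 / (\<alpha> * s1 c1)" "- (\<sigma> c1 / (\<alpha> * s1 c1))"]
      show ?thesis
        by (simp add: diff_divide_distrib algebra_simps del: layer_functions.simps)
    qed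
  qed (rule continuous_on_const uniform_limit_const)+
  then show ?thesis by simp
qed

text \<open>
  A layer of difference quotients approximates the identity, so that approximations of different
  depths can be brought to a common depth.
\<close>

lemma network_C1_limit_Suc:
  assumes "compact B" "network_C1_limit \<sigma> B h f f'"
  shows "network_C1_limit \<sigma> B (Suc h) f f'"
proof -
  obtain g g' where f: "\<And>p. GDERIV f p :> f' p" "continuous_on UNIV f'"
      "\<And>\<alpha>. \<alpha> > 0 \<Longrightarrow> g \<alpha> \<in> layer_functions \<sigma> \<alpha> (Suc h)"
      "\<And>\<alpha> p. \<alpha> > 0 \<Longrightarrow> GDERIV (g \<alpha>) p :> g' \<alpha> p"
      "uniform_limit B g f (at_right 0)" "uniform_limit B g' f' (at_right 0)"
    using assms(2) unfolding network_C1_limit_def by blast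
  have "network_C1_limit \<sigma> B (Suc h) (\<lambda>p. f p) (\<lambda>p. 1 *\<^sub>R f' p)"
  proof (rule network_C1_limit_compose[OF C1_family_limit_difference_quotient[OF DERIV_\<sigma> s1_cont s1_nonzero]
        assms(1) f(1,2) f(4-6)])
    fix \<alpha> :: real assume \<alpha>: "\<alpha> > 0"
    have "(\<lambda>p. \<alpha> * g \<alpha> p + 0 * g \<alpha> p + c1) \<in> layer_functions \<sigma> \<alpha> (Suc h)"
      by (intro layer_functions_affine f(3) \<alpha>)
    from layer_functions_neuron[OF this, of "1 / (\<alpha> * s1 c1)" "- (\<sigma> c1 / (\<alpha> * s1 c1))"]
    show "(\<lambda>p. (\<sigma> (c1 + \<alpha> * g \<alpha> p) - \<sigma> c1) / (\<alpha> * s1 c1)) \<in> layer_functions \<sigma> \<alpha> (Suc (Suc h))"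
      by (simp add: diff_divide_distrib add.commute del: layer_functions.simps)
  qed
  then show ?thesis by simp
qed

lemma network_C1_limit_mono:
  assumes "compact B" "network_C1_limit \<sigma> B h f f'" "h \<le> k"
  shows "network_C1_limit \<sigma> B k f f'"
  using assms(3)
proof (induction rule: dec_induct)
  case base
  show ?case by (rule assms(2))
next
  case (step m)
  show ?case by (rule network_C1_limit_Suc[OF assms(1) step.IH])
qed

text \<open>
  The second difference quotient takes the arguments \<open>c2 + \<alpha> f\<close> and \<open>c2 - \<alpha> f\<close>. Affine maps between
  layers provide both signs. The first layer could not, because its time weight has one sign, so
  squares are formed only from functions that a hidden layer has already computed.
\<close>

lemma network_C1_limit_square:
  assumes "compact B" "network_C1_limit \<sigma> B h f f'"
  shows "network_C1_limit \<sigma> B (Suc h) (\<lambda>p. (f p)\<^sup>2) (\<lambda>p. (2 * f p) *\<^sub>R f' p)"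
proof -
  obtain g g' where f: "\<And>p. GDERIV f p :> f' p" "continuous_on UNIV f'"
      "\<And>\<alpha>. \<alpha> > 0 \<Longrightarrow> g \<alpha> \<in> layer_functions \<sigma> \<alpha> (Suc h)"
      "\<And>\<alpha> p. \<alpha> > 0 \<Longrightarrow> GDERIV (g \<alpha>) p :> g' \<alpha> p"
      "uniform_limit B g f (at_right 0)" "uniform_limit B g' f' (at_right 0)"
    using assms(2) unfolding network_C1_limit_def by blast
  show ?thesis
  proof (rule network_C1_limit_compose[OF
        C1_family_limit_second_difference_quotient[OF DERIV_\<sigma> DERIV_s1 s2_nonzero]
        assms(1) f(1,2) f(4-6)])
    fix \<alpha> :: real assume \<alpha>: "\<alpha> > 0"
    let ?k = "\<alpha>\<^sup>2 * s2"
    have "(\<lambda>p. 1 * \<sigma> (\<alpha> * g \<alpha> p + 0 * g \<alpha> p + c2) + 0) \<in> layer_functions \<sigma> \<alpha> (Suc (Suc h))"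
      by (intro layer_functions_neuron layer_functions_affine f(3) \<alpha>)
    moreover have "(\<lambda>p. 1 * \<sigma> ((- \<alpha>) * g \<alpha> p + 0 * g \<alpha> p + c2) + 0) \<in> layer_functions \<sigma> \<alpha> (Suc (Suc h))"
      by (intro layer_functions_neuron layer_functions_affine f(3) \<alpha>)
    ultimately have "(\<lambda>p. 1 / ?k * (1 * \<sigma> (\<alpha> * g \<alpha> p + 0 * g \<alpha> p + c2) + 0)
        + 1 / ?k * (1 * \<sigma> ((- \<alpha>) * g \<alpha> p + 0 * g \<alpha> p + c2) + 0) + - (2 * \<sigma> c2 / ?k))
        \<in> layer_functions \<sigma> \<alpha> (Suc (Suc h))"
      by (rule layer_functions_affine)
    moreover have "(\<sigma> (c2 + \<alpha> * y) - 2 * \<sigma> c2 + \<sigma> (c2 - \<alpha> * y)) / ?k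
        = 1 / ?k * (1 * \<sigma> (\<alpha> * y + 0 * y + c2) + 0)
        + 1 / ?k * (1 * \<sigma> ((- \<alpha>) * y + 0 * y + c2) + 0) + - (2 * \<sigma> c2 / ?k)" for y
      by (simp add: diff_divide_distrib add_divide_distrib add.commute)
    ultimately show "(\<lambda>p. (\<sigma> (c2 + \<alpha> * g \<alpha> p) - 2 * \<sigma> c2 + \<sigma> (c2 - \<alpha> * g \<alpha> p)) / ?k)
        \<in> layer_functions \<sigma> \<alpha> (Suc (Suc h))"
      by (simp only:)
  qed
qed

text \<open>
  Polarisation: \<open>2 f g = (f + g)\<^sup>2 - f\<^sup>2 - g\<^sup>2\<close>.
\<close>

lemma network_C1_limit_mult:
  assumes B: "compact B" and f: "network_C1_limit \<sigma> B h f f'" and g: "network_C1_limit \<sigma> B h g g'"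
  shows "network_C1_limit \<sigma> B (Suc h) (\<lambda>p. f p * g p) (\<lambda>p. f p *\<^sub>R g' p + g p *\<^sub>R f' p)"
proof -
  have "network_C1_limit \<sigma> B h (\<lambda>p. f p + g p) (\<lambda>p. f' p + g' p)"
    using network_C1_limit_affine[OF f g, of 1 1 0] by simp
  from network_C1_limit_affine[OF network_C1_limit_square[OF B this]
      network_C1_limit_affine[OF network_C1_limit_square[OF B f] network_C1_limit_square[OF B g], of 1 1 0],
      of "1 / 2" "- 1 / 2" 0]
  have "network_C1_limit \<sigma> B (Suc h)
      (\<lambda>p. 1 / 2 * (f p + g p)\<^sup>2 + - 1 / 2 * (1 * (f p)\<^sup>2 + 1 * (g p)\<^sup>2 + 0) + 0)
      (\<lambda>p. (1 / 2) *\<^sub>R (2 * (f p + g p)) *\<^sub>R (f' p + g' p)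
        + (- 1 / 2) *\<^sub>R (1 *\<^sub>R (2 * f p) *\<^sub>R f' p + 1 *\<^sub>R (2 * g p) *\<^sub>R g' p))" .
  moreover have "1 / 2 * (f p + g p)\<^sup>2 + - 1 / 2 * (1 * (f p)\<^sup>2 + 1 * (g p)\<^sup>2 + 0) + 0 = f p * g p" for p
    by (simp add: power2_sum algebra_simps)
  moreover have "(1 / 2) *\<^sub>R (2 * (f p + g p)) *\<^sub>R (f' p + g' p)
        + (- 1 / 2) *\<^sub>R (1 *\<^sub>R (2 * f p) *\<^sub>R f' p + 1 *\<^sub>R (2 * g p) *\<^sub>R g' p)
      = f p *\<^sub>R g' p + g p *\<^sub>R f' p" for p
    by (simp add: scaleR_add_right scaleR_add_left)
  ultimately show ?thesis by (simp only:)
qed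

text \<open>
  Linear functions are combinations of \<open>\<langle>w, x\<rangle> + t\<close> and \<open>t\<close>, which are both limits of the first
  hidden layer; the rest is closure under sums and products.
\<close>

lemma polynomial_network_C1_limit:
  fixes B :: "(real \<times> (real ^ 'n)) set"
  assumes B: "compact B" and p: "real_polynomial_function p"
  shows "\<exists>h p'. network_C1_limit \<sigma> B h p p'"
  using p
proof (induction p rule: real_polynomial_function.induct)
  case (linear f)
  interpret f: bounded_linear f by (fact linear)
  define w where "w = (\<chi> i. f (0, axis i 1))"
  have f_eq: "f p = 1 * (w \<bullet> snd p + fst p) + (f (1, 0) - 1) * (0 \<bullet> snd p + fst p) + 0"
    for p :: "real \<times> (real ^ 'n)"
  proof -
    have "bounded_linear (\<lambda>x. f (0, x))"
      by (rule bounded_linear_compose[OF linear]) (auto intro!: bounded_linear_Pair bounded_linear_zero bounded_linear_ident)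
    then interpret g: bounded_linear "\<lambda>x. f (0, x)" .
    have "f (0, snd p) = f (0, \<Sum>i\<in>UNIV. (snd p $ i) *\<^sub>R axis i 1)"
      using basis_expansion[of "snd p"] by (simp add: scalar_mult_eq_scaleR)
    also have "\<dots> = (\<Sum>i\<in>UNIV. (snd p $ i) * f (0, axis i 1))"
      by (simp add: g.sum g.scaleR)
    also have "\<dots> = w \<bullet> snd p"
      by (simp add: w_def inner_vec_def mult.commute)
    finally have "f (0, snd p) = w \<bullet> snd p" .
    moreover have "p = fst p *\<^sub>R (1, 0) + (0, snd p)"
      by (simp add: prod_eq_iff)
    then have "f p = fst p * f (1, 0) + f (0, snd p)"
      by (metis f.add f.scaleR real_scaleR_def)
    ultimately show ?thesis by (simp add: algebra_simps)
  qed
  have "network_C1_limit \<sigma> B 0 (\<lambda>p. 1 * (w \<bullet> snd p + fst p) + (f (1, 0) - 1) * (0 \<bullet> snd p + fst p) + 0)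
      (\<lambda>p. 1 *\<^sub>R (1, w) + (f (1, 0) - 1) *\<^sub>R (1, 0))"
    by (intro network_C1_limit_affine network_C1_limit_ridge B)
  then show ?case
    unfolding f_eq[symmetric] by blast
next
  case (const c)
  have "network_C1_limit \<sigma> B 0 (\<lambda>p. 0 * (0 \<bullet> snd p + fst p) + 0 * (0 \<bullet> snd p + fst p) + c)
      (\<lambda>p. 0 *\<^sub>R (1, 0) + 0 *\<^sub>R (1, 0))"
    by (intro network_C1_limit_affine network_C1_limit_ridge B)
  then show ?case by auto
next
  case (add f g)
  then obtain h1 f' h2 g' where "network_C1_limit \<sigma> B h1 f f'" "network_C1_limit \<sigma> B h2 g g'"
    by blast
  then have "network_C1_limit \<sigma> B (max h1 h2) f f'" "network_C1_limit \<sigma> B (max h1 h2) g g'"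
    by (auto intro: network_C1_limit_mono[OF B])
  from network_C1_limit_affine[OF this, of 1 1 0] show ?case by auto
next
  case (mult f g)
  then obtain h1 f' h2 g' where "network_C1_limit \<sigma> B h1 f f'" "network_C1_limit \<sigma> B h2 g g'"
    by blast
  then have "network_C1_limit \<sigma> B (max h1 h2) f f'" "network_C1_limit \<sigma> B (max h1 h2) g g'"
    by (auto intro: network_C1_limit_mono[OF B])
  from network_C1_limit_mult[OF B this] show ?case by blast
qed

lemma poly_C1_approximable_imp_network_approximation:
  fixes B :: "(real \<times> (real ^ 'n)) set"
  assumes B: "compact B" and f: "poly_C1_approximable B f G" and e: "e > 0"
  obtains \<theta> :: "('n::finite) network" and N' where
    "\<And>p. GDERIV (case_prod (network_fun \<sigma> \<theta>)) p :> N' p"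
    "\<And>p. p \<in> B \<Longrightarrow> \<bar>network_fun \<sigma> \<theta> (fst p) (snd p) - f p\<bar> < e"
    "\<And>p. p \<in> B \<Longrightarrow> norm (N' p - G p) < e"
proof -
  have e2: "e / 2 > 0" using e by simp
  then obtain p p' where p: "real_polynomial_function p" "\<And>x. GDERIV p x :> p' x"
      "\<And>x. x \<in> B \<Longrightarrow> \<bar>p x - f x\<bar> \<le> e / 2 \<and> norm (p' x - G x) \<le> e / 2"
    using f unfolding poly_C1_approximable_def by metis
  obtain h r where "network_C1_limit \<sigma> B h p r"
    using polynomial_network_C1_limit[OF B p(1)] by blast
  then obtain g g' where r: "\<And>x. GDERIV p x :> r x"
      "\<And>\<alpha>. \<alpha> > 0 \<Longrightarrow> g \<alpha> \<in> layer_functions \<sigma> \<alpha> (Suc h)"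
      "\<And>\<alpha> x. \<alpha> > 0 \<Longrightarrow> GDERIV (g \<alpha>) x :> g' \<alpha> x"
      "uniform_limit B g p (at_right 0)" "uniform_limit B g' r (at_right 0)"
    unfolding network_C1_limit_def by blast
  have same: "r x = p' x" for x
  proof (rule vector_eq_ldot[THEN iffD1], rule allI)
    fix z
    show "z \<bullet> r x = z \<bullet> p' x"
      using has_derivative_unique[OF r(1)[unfolded gderiv_def] p(2)[unfolded gderiv_def]]
      by (rule fun_cong)
  qed
  have "\<forall>\<^sub>F \<alpha> in at_right 0. \<alpha> > 0 \<and> (\<forall>x\<in>B. dist (g \<alpha> x) (p x) < e / 2) \<and> (\<forall>x\<in>B. dist (g' \<alpha> x) (r x) < e / 2)"
    by (intro eventually_conj eventually_at_right_less uniform_limitD[OF r(4) e2] uniform_limitD[OF r(5) e2])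
  then obtain \<alpha> :: real where \<alpha>: "\<alpha> > 0" "\<And>x. x \<in> B \<Longrightarrow> dist (g \<alpha> x) (p x) < e / 2"
      "\<And>x. x \<in> B \<Longrightarrow> dist (g' \<alpha> x) (r x) < e / 2"
    using eventually_happens'[OF trivial_limit_at_right_real] by blast
  obtain \<theta> :: "('n::finite) network" where \<theta>: "\<And>t x. network_fun \<sigma> \<theta> t x = g \<alpha> (t, x)"
    using layer_function_is_network[OF r(2)[OF \<alpha>(1)]] by blast
  have eq: "case_prod (network_fun \<sigma> \<theta>) = g \<alpha>"
    by (auto simp: \<theta>)
  show ?thesis
  proof (rule that)
    show "GDERIV (case_prod (network_fun \<sigma> \<theta>)) x :> g' \<alpha> x" for x
      unfolding eq by (rule r(3)[OF \<alpha>(1)])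
    show "\<bar>network_fun \<sigma> \<theta> (fst x) (snd x) - f x\<bar> < e" if "x \<in> B" for x
      using \<alpha>(2)[OF that] p(3)[OF that] unfolding \<theta> dist_real_def prod.collapse by linarith
    show "norm (g' \<alpha> x - G x) < e" if "x \<in> B" for x
      using norm_triangle_ineq[of "g' \<alpha> x - r x" "r x - G x"] \<alpha>(3)[OF that] p(3)[OF that]
      unfolding same dist_norm by simp
  qed
qed

end

text \<open>
  If \<open>\<sigma>'\<close> vanished, \<open>\<sigma>\<close> would be constant. If \<open>\<sigma>''\<close> vanished, \<open>\<sigma>\<close> would be affine with non-zero
  slope, hence unbounded.
\<close>

lemma bounded_smooth_activation_nonaffine:
  assumes "smooth_activation \<sigma>" "bounded (range \<sigma>)" "\<not> \<sigma> constant_on UNIV"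
  obtains c1 c2 where "smooth_nonaffine \<sigma> (deriv \<sigma>) c1 c2 (deriv (deriv \<sigma>) c2)"
proof -
  have d1: "(\<sigma> has_real_derivative deriv \<sigma> x) (at x)" for x
    using assms(1) DERIV_deriv_iff_real_differentiable unfolding smooth_activation_def
    by (metis funpow_0)
  have d2: "(deriv \<sigma> has_real_derivative deriv (deriv \<sigma>) x) (at x)" for x
    using assms(1) DERIV_deriv_iff_real_differentiable unfolding smooth_activation_def
    by (metis funpow_0 funpow.simps(2) comp_apply)
  have nonconst: "\<exists>c. deriv \<sigma> c \<noteq> 0"
  proof (rule ccontr)
    assume "\<nexists>c. deriv \<sigma> c \<noteq> 0"
    then have "(\<sigma> has_real_derivative 0) (at x)" for x
      using d1[of x] by simp
    then have "\<sigma> x = \<sigma> y" for x y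
      using DERIV_isconst_all by blast
    then show False
      using assms(3) unfolding constant_on_def by blast
  qed
  then obtain c1 where c1: "deriv \<sigma> c1 \<noteq> 0" by blast
  have "\<exists>c. deriv (deriv \<sigma>) c \<noteq> 0"
  proof (rule ccontr)
    assume "\<nexists>c. deriv (deriv \<sigma>) c \<noteq> 0"
    then have "(deriv \<sigma> has_real_derivative 0) (at x)" for x
      using d2[of x] by simp
    then have const: "deriv \<sigma> x = deriv \<sigma> c1" for x
      using DERIV_isconst_all by blast
    define m where "m = deriv \<sigma> c1"
    have "((\<lambda>x. \<sigma> x - m * x) has_real_derivative 0) (at x)" for x
    proof -
      have "((\<lambda>x. \<sigma> x - m * x) has_real_derivative m - m * 1) (at x)"
        using d1[of x] unfolding const[of x] m_def by (intro DERIV_diff DERIV_cmult DERIV_ident)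
      then show ?thesis by simp
    qed
    then have eq: "\<sigma> x - m * x = \<sigma> 0 - m * 0" for x
      using DERIV_isconst_all[of "\<lambda>x. \<sigma> x - m * x" x 0] by blast
    have affine: "\<sigma> x = \<sigma> 0 + m * x" for x
      using eq[of x] by linarith
    obtain M where M: "\<And>x. \<bar>\<sigma> x\<bar> \<le> M"
      using assms(2) unfolding bounded_iff by auto
    \<comment> \<open>A point at which the affine function differs from \<open>\<sigma> 0\<close> by more than \<open>2 M\<close>.\<close>
    have "\<sigma> ((2 * M + 1) / m) = \<sigma> 0 + (2 * M + 1)"
      using affine[of "(2 * M + 1) / m"] c1 by (simp add: m_def)
    then show False
      using M[of "(2 * M + 1) / m"] M[of 0] by linarith
  qed
  then obtain c2 where "deriv (deriv \<sigma>) c2 \<noteq> 0" by blast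
  then have "smooth_nonaffine \<sigma> (deriv \<sigma>) c1 c2 (deriv (deriv \<sigma>) c2)"
  proof unfold_locales
    show "(\<sigma> has_real_derivative deriv \<sigma> x) (at x)" for x by (rule d1)
    show "isCont (deriv \<sigma>) c1" by (rule DERIV_isCont[OF d2])
  qed (rule c1 d2 | assumption)+
  then show ?thesis by (rule that)
qed

section \<open>Stability of the HJI operator\<close>

text \<open>
  Restricting the full derivative to the lines \<open>(\<cdot>, x)\<close> and \<open>(t, \<cdot>)\<close> evaluates the descriptions by
  which the two partial derivatives are defined. On the boundary of the time
  interval this is the one-sided derivative, for the network as well as for the value function.
\<close>

lemma time_deriv_space_grad_of_has_derivative:
  fixes v :: "real \<Rightarrow> real ^ 'n \<Rightarrow> real"
  assumes der: "(case_prod v has_derivative (\<lambda>h. h \<bullet> g)) (at (t, x) within {0..T} \<times> UNIV)"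
    and T: "0 < T" and t: "t \<in> {0..T}"
  shows "time_deriv T v t x = fst g" "space_grad v t x = snd g"
proof -
  have "((\<lambda>s. (s, x)) has_derivative (\<lambda>h. (h, 0))) (at t within {0..T})"
    by (intro has_derivative_Pair has_derivative_ident has_derivative_const)
  moreover have "(case_prod v has_derivative (\<lambda>h. h \<bullet> g)) (at (t, x) within (\<lambda>s. (s, x)) ` {0..T})"
    by (rule has_derivative_subset[OF der]) auto
  ultimately have "((\<lambda>s. case_prod v (s, x)) has_derivative (\<lambda>h. (h, 0) \<bullet> g)) (at t within {0..T})"
    by (rule has_derivative_in_compose)
  then have "((\<lambda>s. v s x) has_vector_derivative fst g) (at t within {0..T})"
    by (simp add: has_vector_derivative_def inner_prod_def)
  then show "time_deriv T v t x = fst g"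
    unfolding time_deriv_def by (rule vector_derivative_within_closed_interval[OF T t])
  have "((\<lambda>y. (t, y)) has_derivative (\<lambda>h. (0, h))) (at x)"
    by (intro has_derivative_Pair has_derivative_ident has_derivative_const)
  moreover have "(case_prod v has_derivative (\<lambda>h. h \<bullet> g)) (at (t, x) within (\<lambda>y. (t, y)) ` UNIV)"
    by (rule has_derivative_subset[OF der]) (use t in auto)
  ultimately have "((\<lambda>y. case_prod v (t, y)) has_derivative (\<lambda>h. (0, h) \<bullet> g)) (at x)"
    by (rule has_derivative_in_compose)
  then have grad: "GDERIV (v t) x :> snd g"
    by (simp add: gderiv_def inner_prod_def)
  show "space_grad v t x = snd g"
    unfolding space_grad_def
  proof (rule the_equality)
    show "GDERIV (v t) x :> snd g" by (rule grad)
  next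
    fix g' assume "GDERIV (v t) x :> g'"
    then have "(\<lambda>h. h \<bullet> g') = (\<lambda>h. h \<bullet> snd g)"
      using grad unfolding gderiv_def by (rule has_derivative_unique)
    then show "g' = snd g"
      by (metis vector_eq_ldot)
  qed
qed

text \<open>
  For every pair of inputs the two inner products differ by at most \<open>C \<delta>\<close>, and suprema and infima
  preserve such a bound. The bound on \<open>F\<close> also provides the boundedness without which suprema and
  infima of reals are unspecified.
\<close>

lemma SUP_INF_inner_le:
  fixes F :: "'u \<Rightarrow> 'd \<Rightarrow> 'a::real_inner"
  assumes "U \<noteq> {}" "D \<noteq> {}" and F: "\<And>u d. u \<in> U \<Longrightarrow> d \<in> D \<Longrightarrow> norm (F u d) \<le> C"
    and gg': "norm (g - g') \<le> \<delta>"
  shows "(SUP u\<in>U. INF d\<in>D. g \<bullet> F u d) \<le> (SUP u\<in>U. INF d\<in>D. g' \<bullet> F u d) + C * \<delta>"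
proof -
  obtain d0 where d0: "d0 \<in> D" using assms(2) by blast
  obtain u0 where u0: "u0 \<in> U" using assms(1) by blast
  have C: "0 \<le> C"
    using F[OF u0 d0] norm_ge_zero order_trans by blast
  have inner_bound: "\<bar>k \<bullet> F u d\<bar> \<le> norm k * C" if "u \<in> U" "d \<in> D" for k u d
    by (rule order_trans[OF Cauchy_Schwarz_ineq2 mult_left_mono[OF F[OF that] norm_ge_zero]])
  have below: "bdd_below ((\<lambda>d. k \<bullet> F u d) ` D)" if "u \<in> U" for k u
    by (rule bdd_belowI2[of _ "- (norm k * C)"]) (use inner_bound[OF that, of _ k] in \<open>force simp: abs_le_iff\<close>)
  have above: "bdd_above ((\<lambda>u. INF d\<in>D. g' \<bullet> F u d) ` U)"
  proof (rule bdd_aboveI2)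
    fix u assume u: "u \<in> U"
    have "(INF d\<in>D. g' \<bullet> F u d) \<le> g' \<bullet> F u d0"
      by (rule cINF_lower[OF below[OF u] d0])
    also have "\<dots> \<le> norm g' * C"
      using inner_bound[OF u d0, of g'] by linarith
    finally show "(INF d\<in>D. g' \<bullet> F u d) \<le> norm g' * C" .
  qed
  show ?thesis
  proof (rule cSUP_least[OF assms(1)])
    fix u assume u: "u \<in> U"
    have "(INF d\<in>D. g \<bullet> F u d) - C * \<delta> \<le> (INF d\<in>D. g' \<bullet> F u d)"
    proof (rule cINF_greatest[OF assms(2)])
      fix d assume d: "d \<in> D"
      have "(INF d\<in>D. g \<bullet> F u d) \<le> g \<bullet> F u d"
        by (rule cINF_lower[OF below[OF u] d])
      also have "\<dots> = g' \<bullet> F u d + (g - g') \<bullet> F u d"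
        by (simp add: inner_diff_left)
      also have "\<dots> \<le> g' \<bullet> F u d + C * \<delta>"
        using inner_bound[OF u d, of "g - g'"] mult_right_mono[OF gg' C] by (simp add: mult.commute)
      finally show "(INF d\<in>D. g \<bullet> F u d) - C * \<delta> \<le> g' \<bullet> F u d" by linarith
    qed
    also have "\<dots> \<le> (SUP u\<in>U. INF d\<in>D. g' \<bullet> F u d)"
      by (rule cSUP_upper[OF u above])
    finally show "(INF d\<in>D. g \<bullet> F u d) \<le> (SUP u\<in>U. INF d\<in>D. g' \<bullet> F u d) + C * \<delta>"
      by linarith
  qed
qed

lemma hamiltonian_close:
  assumes "U \<noteq> {}" "D \<noteq> {}" and f: "\<And>u d. u \<in> U \<Longrightarrow> d \<in> D \<Longrightarrow> norm (f x u d) \<le> C"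
    and "norm (space_grad v t x - space_grad w t x) \<le> \<delta>"
  shows "\<bar>hamiltonian f U D v t x - hamiltonian f U D w t x\<bar> \<le> C * \<delta>"
proof -
  have "hamiltonian f U D v t x \<le> hamiltonian f U D w t x + C * \<delta>"
    unfolding hamiltonian_def by (rule SUP_INF_inner_le) (fact assms)+
  moreover have "hamiltonian f U D w t x \<le> hamiltonian f U D v t x + C * \<delta>"
    unfolding hamiltonian_def
    by (rule SUP_INF_inner_le) (use assms in \<open>simp_all add: norm_minus_commute\<close>)
  ultimately show ?thesis by linarith
qed

lemma HJI_op_close:
  assumes "U \<noteq> {}" "D \<noteq> {}" and f: "\<And>u d. u \<in> U \<Longrightarrow> d \<in> D \<Longrightarrow> norm (f x u d) \<le> C" and "0 \<le> C"
    and vals: "\<bar>v t x - w t x\<bar> \<le> \<delta>"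
    and time: "\<bar>time_deriv T v t x - time_deriv T w t x\<bar> \<le> \<delta>"
    and space: "norm (space_grad v t x - space_grad w t x) \<le> \<delta>"
  shows "\<bar>HJI_op f U D ell T v t x - HJI_op f U D ell T w t x\<bar> \<le> (1 + C) * \<delta>"
proof -
  have "0 \<le> C * \<delta>"
    using \<open>0 \<le> C\<close> vals by (intro mult_nonneg_nonneg) linarith+
  moreover have "\<bar>hamiltonian f U D v t x - hamiltonian f U D w t x\<bar> \<le> C * \<delta>"
    by (rule hamiltonian_close) (fact assms)+
  ultimately show ?thesis
    using vals time unfolding HJI_op_def min_def distrib_right by (simp split: if_splits) linarith
qed

section \<open>Networks are dense in \<open>C\<^sup>1\<close>\<close>

lemma locally_lipschitz_on_continuous_on:
  assumes "locally_lipschitz_on S g"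
  shows "continuous_on S g"
  unfolding continuous_on_eq_continuous_within
proof
  fix p assume p: "p \<in> S"
  then obtain r L where "r > 0" "L-lipschitz_on (S \<inter> ball p r) g"
    using assms unfolding locally_lipschitz_on_def by blast
  then have "continuous (at p within S \<inter> ball p r) g"
    using p lipschitz_on_continuous_within[of L "S \<inter> ball p r" g p] by simp
  moreover have "at p within S \<inter> ball p r = at p within S"
    by (rule at_within_nhd[of p "ball p r"]) (use \<open>r > 0\<close> in auto)
  ultimately show "continuous (at p within S) g" by simp
qed

text \<open>
  \<open>K\<close> is enclosed in a cube and \<open>v\<close> is approximated in \<open>C\<^sup>1\<close> on the product of \<open>[0,T]\<close> and this cube,
  first by a polynomial and then by a network. The approximation takes place on a box
  although only \<open>K\<close> matters, because the Bernstein operator needs a product domain.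
\<close>

theorem network_C1_approximation:
  fixes v :: "real \<Rightarrow> real ^ 'n \<Rightarrow> real"
  assumes \<sigma>: "smooth_activation \<sigma>" "bounded (range \<sigma>)" "\<not> \<sigma> constant_on UNIV"
    and T: "0 < T" and K: "bounded K" and v: "C11_loc T v" and \<delta>: "0 < \<delta>"
  obtains \<theta> :: "'n network" where
    "\<And>t x. t \<in> {0..T} \<Longrightarrow> x \<in> K \<Longrightarrow>
       \<bar>network_fun \<sigma> \<theta> t x - v t x\<bar> \<le> \<delta> \<and>
       \<bar>time_deriv T (network_fun \<sigma> \<theta>) t x - time_deriv T v t x\<bar> \<le> \<delta> \<and>
       norm (space_grad (network_fun \<sigma> \<theta>) t x - space_grad v t x) \<le> \<delta>"
proof -
  obtain G where G_left: "\<And>p. p \<in> {0..T} \<times> UNIV \<Longrightarrow>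
        (case_prod v has_derivative (\<lambda>h. G p \<bullet> h)) (at p within {0..T} \<times> UNIV)"
      and G_lip: "locally_lipschitz_on ({0..T} \<times> UNIV) G"
    using v unfolding C11_loc_def by blast
  have G: "(case_prod v has_derivative (\<lambda>h. h \<bullet> G p)) (at p within {0..T} \<times> UNIV)"
    if "p \<in> {0..T} \<times> UNIV" for p
    by (rule has_derivative_eq_rhs[OF G_left[OF that]]) (rule ext, rule inner_commute)
  have G_cont: "continuous_on ({0..T} \<times> UNIV) G"
    by (rule locally_lipschitz_on_continuous_on[OF G_lip])
  obtain R where R: "0 < R" "\<And>x. x \<in> K \<Longrightarrow> norm x \<le> R"
    using K unfolding bounded_pos by blast
  define a b :: "real \<times> (real ^ 'n)" where "a = (0, - R *\<^sub>R One)" and "b = (T, R *\<^sub>R One)"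
  have box: "a \<bullet> i < b \<bullet> i" if "i \<in> Basis" for i
    using that T R(1) by (auto simp: a_def b_def Basis_prod_def)
  have box_sub: "cbox a b \<subseteq> {0..T} \<times> UNIV"
    by (auto simp: a_def b_def cbox_Pair_eq)
  have K_box: "(t, x) \<in> cbox a b" if "t \<in> {0..T}" "x \<in> K" for t x
  proof -
    have "- R \<le> x \<bullet> i \<and> x \<bullet> i \<le> R" if "i \<in> Basis" for i
      using Basis_le_norm[OF that, of x] R(2)[OF \<open>x \<in> K\<close>] by (simp add: abs_le_iff)
    then have "x \<in> cbox (- R *\<^sub>R One) (R *\<^sub>R One)"
      by (simp add: mem_box)
    then show ?thesis
      using that(1) by (auto simp: a_def b_def cbox_Pair_eq)
  qed
  have approx: "poly_C1_approximable (cbox a b) (case_prod v) G"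
    by (rule C1_imp_poly_C1_approximable[OF box continuous_on_subset[OF G_cont box_sub]])
       (use G box_sub in \<open>auto intro: has_derivative_subset\<close>)
  obtain c1 c2 where "smooth_nonaffine \<sigma> (deriv \<sigma>) c1 c2 (deriv (deriv \<sigma>) c2)"
    using bounded_smooth_activation_nonaffine[OF \<sigma>] by blast
  then interpret smooth_nonaffine \<sigma> "deriv \<sigma>" c1 c2 "deriv (deriv \<sigma>) c2" .
  obtain \<theta> :: "'n network" and N' where
    N: "\<And>p. GDERIV (case_prod (network_fun \<sigma> \<theta>)) p :> N' p"
      "\<And>p. p \<in> cbox a b \<Longrightarrow> \<bar>network_fun \<sigma> \<theta> (fst p) (snd p) - case_prod v p\<bar> < \<delta>"
      "\<And>p. p \<in> cbox a b \<Longrightarrow> norm (N' p - G p) < \<delta>"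
    using poly_C1_approximable_imp_network_approximation[OF compact_cbox approx \<delta>] by blast
  show ?thesis
  proof (rule that)
    fix t x assume tx: "t \<in> {0..T}" "x \<in> K"
    have "(case_prod (network_fun \<sigma> \<theta>) has_derivative (\<lambda>h. h \<bullet> N' (t, x)))
        (at (t, x) within {0..T} \<times> UNIV)"
      by (rule has_derivative_at_withinI[OF N(1)[unfolded gderiv_def]])
    note net = time_deriv_space_grad_of_has_derivative[OF this T tx(1)]
    have "(case_prod v has_derivative (\<lambda>h. h \<bullet> G (t, x))) (at (t, x) within {0..T} \<times> UNIV)"
      by (rule G) (use tx in simp)
    note val = time_deriv_space_grad_of_has_derivative[OF this T tx(1)]
    have "norm (N' (t, x) - G (t, x)) \<le> \<delta>"
      by (rule less_imp_le[OF N(3)[OF K_box[OF tx]]])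
    then have "norm (fst (N' (t, x) - G (t, x))) \<le> \<delta>" "norm (snd (N' (t, x) - G (t, x))) \<le> \<delta>"
      using norm_fst_le[of "fst (N' (t, x) - G (t, x))" "snd (N' (t, x) - G (t, x))"]
        norm_snd_le[of "snd (N' (t, x) - G (t, x))" "fst (N' (t, x) - G (t, x))"]
      unfolding prod.collapse by linarith+
    then show "\<bar>network_fun \<sigma> \<theta> t x - v t x\<bar> \<le> \<delta> \<and>
       \<bar>time_deriv T (network_fun \<sigma> \<theta>) t x - time_deriv T v t x\<bar> \<le> \<delta> \<and>
       norm (space_grad (network_fun \<sigma> \<theta>) t x - space_grad v t x) \<le> \<delta>"
      unfolding net val using N(2)[OF K_box[OF tx]] by simp
  qed
qed

section \<open>The loss can be made small\<close>

lemma sup_norm_on_le: "(\<And>p. p \<in> S \<Longrightarrow> \<bar>g p\<bar> \<le> c) \<Longrightarrow> sup_norm_on S g \<le> ennreal c"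
  unfolding sup_norm_on_def by (intro SUP_least ennreal_leI)

theorem theorem4p1:
  fixes f :: "real ^ 'n \<Rightarrow> real ^ 'm \<Rightarrow> real ^ 'm \<Rightarrow> real ^ 'n"
  shows "\<exists>C>0. \<forall>(U :: (real ^ 'm) set) (D :: (real ^ 'm) set) (K :: (real ^ 'n) set) (T :: real)
      (ell :: real ^ 'n \<Rightarrow> real) (\<xi> :: ('n, 'm) flow) (V :: real \<Rightarrow> real ^ 'n \<Rightarrow> real)
      (\<sigma> :: real \<Rightarrow> real) (lam :: real) (\<epsilon> :: real).
      T > 0 \<and>
      is_state_map f U D T \<xi> \<and>
      assumption_A f U D ell T \<xi> K \<and>
      is_value_function U D ell T \<xi> V \<and>
      assumption_B f U D ell T K V \<and>
      C11_loc T V \<and>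
      smooth_activation \<sigma> \<and> bounded (range \<sigma>) \<and> \<not> \<sigma> constant_on UNIV \<and>
      lam > 0 \<and> \<epsilon> > 0
      \<longrightarrow> (\<exists>\<theta> :: 'n network. deepreach_loss f U D ell T K lam \<sigma> \<theta> \<le> ennreal (C * \<epsilon>))"
proof (intro exI[of _ 1] conjI allI impI)
  fix U D :: "(real ^ 'm) set" and K :: "(real ^ 'n) set" and T :: real
    and ell :: "real ^ 'n \<Rightarrow> real" and \<xi> :: "('n, 'm) flow" and V :: "real \<Rightarrow> real ^ 'n \<Rightarrow> real"
    and \<sigma> :: "real \<Rightarrow> real" and lam \<epsilon> :: real
  assume H: "T > 0 \<and>
      is_state_map f U D T \<xi> \<and>
      assumption_A f U D ell T \<xi> K \<and>
      is_value_function U D ell T \<xi> V \<and>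
      assumption_B f U D ell T K V \<and>
      C11_loc T V \<and>
      smooth_activation \<sigma> \<and> bounded (range \<sigma>) \<and> \<not> \<sigma> constant_on UNIV \<and>
      lam > 0 \<and> \<epsilon> > 0"
  then have T: "T > 0" and A: "assumption_A f U D ell T \<xi> K" and B: "assumption_B f U D ell T K V"
    and V: "C11_loc T V" and \<sigma>: "smooth_activation \<sigma>" "bounded (range \<sigma>)" "\<not> \<sigma> constant_on UNIV"
    and lam: "lam > 0" and \<epsilon>: "\<epsilon> > 0"
    by blast+
  have UD: "U \<noteq> {}" "D \<noteq> {}" and K: "bounded K"
    using A unfolding assumption_A_def by (auto intro: compact_imp_bounded)
  obtain Cf where Cf: "Cf > 0" "\<And>x u d. x \<in> K \<Longrightarrow> u \<in> U \<Longrightarrow> d \<in> D \<Longrightarrow> norm (f x u d) \<le> Cf"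
    using A unfolding assumption_A_def by blast
  have HJI: "\<And>t x. t \<in> {0..T} \<Longrightarrow> x \<in> K \<Longrightarrow> HJI_op f U D ell T V t x = 0"
    and terminal: "\<And>x. x \<in> K \<Longrightarrow> V T x = ell x"
    using B unfolding assumption_B_def classical_solution_def by blast+
  \<comment> \<open>The boundary term of the loss will be at most \<open>\<delta>\<close>, the residual at most \<open>(1 + Cf) \<delta>\<close>.\<close>
  define \<delta> where "\<delta> = \<epsilon> / (1 + lam * (1 + Cf))"
  have denom: "1 + lam * (1 + Cf) > 0"
    using lam Cf(1) by (intro add_pos_pos mult_pos_pos) auto
  then have \<delta>: "\<delta> > 0" and "\<delta> * (1 + lam * (1 + Cf)) = \<epsilon>"
    using \<epsilon> by (simp_all add: \<delta>_def)
  then have budget: "\<delta> + lam * ((1 + Cf) * \<delta>) = \<epsilon>"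
    by (simp add: algebra_simps)
  obtain \<theta> :: "'n network" where \<theta>:
    "\<And>t x. t \<in> {0..T} \<Longrightarrow> x \<in> K \<Longrightarrow>
       \<bar>network_fun \<sigma> \<theta> t x - V t x\<bar> \<le> \<delta> \<and>
       \<bar>time_deriv T (network_fun \<sigma> \<theta>) t x - time_deriv T V t x\<bar> \<le> \<delta> \<and>
       norm (space_grad (network_fun \<sigma> \<theta>) t x - space_grad V t x) \<le> \<delta>"
    using network_C1_approximation[OF \<sigma> T K V \<delta>] by blast
  have boundary: "sup_norm_on K (\<lambda>x. network_fun \<sigma> \<theta> T x - ell x) \<le> ennreal \<delta>"
  proof (rule sup_norm_on_le)
    fix x assume x: "x \<in> K"
    then show "\<bar>network_fun \<sigma> \<theta> T x - ell x\<bar> \<le> \<delta>"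
      using \<theta>[of T x] T terminal[OF x] by simp
  qed
  have residual: "sup_norm_on ({0..T} \<times> K) (\<lambda>(t, x). HJI_op f U D ell T (network_fun \<sigma> \<theta>) t x)
      \<le> ennreal ((1 + Cf) * \<delta>)"
  proof (rule sup_norm_on_le, clarify)
    fix t x assume t: "t \<in> {0..T}" and x: "x \<in> K"
    have "\<bar>HJI_op f U D ell T (network_fun \<sigma> \<theta>) t x - HJI_op f U D ell T V t x\<bar> \<le> (1 + Cf) * \<delta>"
      by (rule HJI_op_close[OF UD]) (use Cf x \<theta>[OF t x] in auto)
    then show "\<bar>HJI_op f U D ell T (network_fun \<sigma> \<theta>) t x\<bar> \<le> (1 + Cf) * \<delta>"
      by (simp add: HJI[OF t x])
  qed
  have "deepreach_loss f U D ell T K lam \<sigma> \<theta> \<le> ennreal \<delta> + ennreal lam * ennreal ((1 + Cf) * \<delta>)"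
    unfolding deepreach_loss_def by (intro add_mono boundary mult_left_mono residual) simp
  also have "\<dots> = ennreal (\<delta> + lam * ((1 + Cf) * \<delta>))"
    using \<delta> lam Cf(1) by (simp add: ennreal_mult[symmetric] ennreal_plus[symmetric] del: ennreal_plus)
  also have "\<dots> = ennreal (1 * \<epsilon>)"
    by (simp add: budget)
  finally show "\<exists>\<theta> :: 'n network. deepreach_loss f U D ell T K lam \<sigma> \<theta> \<le> ennreal (1 * \<epsilon>)"
    by blast
qed simp

end
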